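(* Let $I$ be a left ideal of $\mathbb{H}[x_1,\ldots,x_d]$ and let $I'=\varphi(I)+\mathbf{i}\varphi(I)\subseteq M_2(\mathbb{C}[x_1,\ldots,x_d])$. For every $f \in \mathbb{H}[x_1,\ldots,x_d]$ the following are equivalent: (1) $f \in \sqrt{I}$; (2) $\varphi(f) \in \sqrt{I'}$; (3) $\varphi(f)$ belongs to the smallest semiprime left ideal of $M_2(\mathbb{C}[x_1,\ldots,x_d])$ containing $I'$; (4) $f$ belongs to the smallest semiprime left ideal of $\mathbb{H}[x_1,\ldots,x_d]$ containing $I$; (5) for every matrix $A \in M_2(\mathbb{C})$ there exists $N \in \mathbb{N}_0$ such that $(A\varphi(f))^N \in I'+I'(A\varphi(f))+\ldots+I'(A\varphi(f))^N$; (6) for every $b \in \mathbb{H}$ there exists $N \in \mathbb{N}_0$ such that $(bf)^N \in I+I(bf)+\ldots+I(bf)^N$.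
   Context: $\mathbb{H}$ denotes the real quaternions with standard units $\mathbf{i},\mathbf{j},\mathbf{k}$, and $\mathbb{H}[x_1,\ldots,x_d]$ is the ring of quaternionic polynomials in $d$ central variables. We view $\mathbb{C}[x_1,\ldots,x_d]=\{r_0+r_1\mathbf{i}\mid r_0,r_1\in\mathbb{R}[x_1,\ldots,x_d]\}$ as a subring, with $\overline{r_0+r_1\mathbf{i}}=r_0-r_1\mathbf{i}$ for $r_0,r_1\in\mathbb{R}[x_1,\ldots,x_d]$. Every element of $\mathbb{H}[x_1,\ldots,x_d]$ can be uniquely written as $p+\mathbf{j}q$ with $p,q\in\mathbb{C}[x_1,\ldots,x_d]$, and $\varphi\colon\mathbb{H}[x_1,\ldots,x_d]\to M_2(\mathbb{C}[x_1,\ldots,x_d])$ is the ring homomorphism $$\varphi(p+\mathbf{j}q)=\left[\begin{array}{cc} p & -\bar q\\ q & \bar p\end{array}\right].$$ In $\varphi(I)+\mathbf{i}\varphi(I)$ the factor $\mathbf{i}$ acts as scalar multiplication by the imaginary unit of $\mathbb{C}$; the set $\varphi(I)+\mathbf{i}\varphi(I)=\{\varphi(u)+\mathbf{i}\varphi(v)\mid u,v\in I\}$ is a left ideal of $M_2(\mathbb{C}[x_1,\ldots,x_d])$. Radical in $\mathbb{H}[x_1,\ldots,x_d]$: for $f=\sum c_{i_1,\ldots,i_d}x_1^{i_1}\cdots x_d^{i_d}$ and $a\in\mathbb{H}^d$ put $f(a)=\sum c_{i_1,\ldots,i_d}a_1^{i_1}\cdots a_d^{i_d}$. Let $\mathbb{H}_c^d$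 be the set of $a\in\mathbb{H}^d$ with $a_ia_j=a_ja_i$ for all $i,j$. Then $\sqrt{I}$ is the set of all $f$ such that $f(a)=0$ for every $a\in\mathbb{H}_c^d$ satisfying $g(a)=0$ for all $g\in I$. Radical in $M_2(\mathbb{C}[x_1,\ldots,x_d])$: for a left ideal $L$, $\sqrt{L}$ is the set of all $F$ such that $F(c)w=0$ for every pair $(c,w)$ with $c\in\mathbb{C}^d$ and $0\neq w\in\mathbb{C}^2$ satisfying $G(c)w=0$ for all $G\in L$. A left ideal $L$ of an associative unital ring $A$ is semiprime if for every $a\in A$ with $aAa\subseteq L$ we have $a\in L$. For $f\in A$, $Lf^k=\{gf^k\mid g\in L\}$. *)

theory Defs
  imports "HOL-Analysis.Analysis" "HOL-Library.Poly_Mapping" "HOL-Algebra.AbelCoset"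
begin

section \<open>Quaternions\<close>

codatatype quat = Quat (Re0: real) (Im1: real) (Im2: real) (Im3: real)

lemma quat_eq_iff:
  "x = y \<longleftrightarrow> Re0 x = Re0 y \<and> Im1 x = Im1 y \<and> Im2 x = Im2 y \<and> Im3 x = Im3 y"
  by (auto intro: quat.expand)

instantiation quat :: ring_1
begin

primcorec zero_quat where
  "Re0 0 = 0" | "Im1 0 = 0" | "Im2 0 = 0" | "Im3 0 = 0"

primcorec one_quat where
  "Re0 1 = 1" | "Im1 1 = 0" | "Im2 1 = 0" | "Im3 1 = 0"

primcorec plus_quat where
  "Re0 (x + y) = Re0 x + Re0 y"
| "Im1 (x + y) = Im1 x + Im1 y"
| "Im2 (x + y) = Im2 x + Im2 y"
| "Im3 (x + y) = Im3 x + Im3 y"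

primcorec uminus_quat where
  "Re0 (- x) = - Re0 x"
| "Im1 (- x) = - Im1 x"
| "Im2 (- x) = - Im2 x"
| "Im3 (- x) = - Im3 x"

primcorec minus_quat where
  "Re0 (x - y) = Re0 x - Re0 y"
| "Im1 (x - y) = Im1 x - Im1 y"
| "Im2 (x - y) = Im2 x - Im2 y"
| "Im3 (x - y) = Im3 x - Im3 y"

primcorec times_quat where
  "Re0 (x * y) = Re0 x * Re0 y - Im1 x * Im1 y - Im2 x * Im2 y - Im3 x * Im3 y"
| "Im1 (x * y) = Re0 x * Im1 y + Im1 x * Re0 y + Im2 x * Im3 y - Im3 x * Im2 y"
| "Im2 (x * y) = Re0 x * Im2 y - Im1 x * Im3 y + Im2 x * Re0 y + Im3 x * Im1 y"
| "Im3 (x * y) = Re0 x * Im3 y + Im1 x * Im2 y - Im2 x * Im1 y + Im3 x * Re0 y"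

instance
  by standard (auto simp: quat_eq_iff algebra_simps)

end

definition quat_i :: quat where "quat_i = Quat 0 1 0 0"
definition quat_j :: quat where "quat_j = Quat 0 0 1 0"
definition quat_k :: quat where "quat_k = Quat 0 0 0 1"

lemma quat_units:
  "quat_i * quat_i = -1" "quat_j * quat_j = -1" "quat_k * quat_k = -1"
  "quat_i * quat_j = quat_k" "quat_j * quat_k = quat_i" "quat_k * quat_i = quat_j"
  by (simp_all add: quat_eq_iff quat_i_def quat_j_def quat_k_def)

definition quat_of_complex :: "complex \<Rightarrow> quat" where
  "quat_of_complex z = Quat (Re z) (Im z) 0 0"

text \<open>
  The two complex coordinates of a quaternion \<open>h = z + \<^bold>j w\<close>.  The sign in the second one comes
  from \<open>\<^bold>j \<^bold>i = - \<^bold>k\<close>.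
\<close>

definition cpart :: "quat \<Rightarrow> complex" where
  "cpart h = Complex (Re0 h) (Im1 h)"

definition jpart :: "quat \<Rightarrow> complex" where
  "jpart h = Complex (Im2 h) (- Im3 h)"

lemma quat_decomp_iff:
  "h = quat_of_complex z + quat_j * quat_of_complex w \<longleftrightarrow> z = cpart h \<and> w = jpart h"
  by (auto simp: quat_eq_iff complex_eq_iff quat_of_complex_def quat_j_def cpart_def jpart_def)


section \<open>Polynomials in central variables\<close>

text \<open>
  The variables are indexed by a finite linearly ordered type \<open>'d\<close>, so \<open>d = CARD('d)\<close>.  The
  convolution product of \<open>HOL-Library.Poly_Mapping\<close> makes the variables commute with each other
  and with all coefficients.
\<close>

type_synonym ('d, 'a) mpoly = "('d \<Rightarrow>\<^sub>0 nat) \<Rightarrow>\<^sub>0 'a"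
type_synonym 'd hpoly = "('d, quat) mpoly"
type_synonym 'd cpoly_mat = "('d, complex) mpoly ^ 2 ^ 2"

abbreviation Const :: "'a::zero \<Rightarrow> ('d, 'a) mpoly" where
  "Const c \<equiv> Poly_Mapping.single 0 c"

text \<open>
  The product \<open>a\<^sub>1\<^bsup>i\<^sub>1\<^esup> \<cdots> a\<^sub>d\<^bsup>i\<^sub>d\<^esup>\<close> is taken in the order of the index type, as the coordinates of
  \<open>a\<close> need not commute.
\<close>

definition monom_value ::
  "'a::semiring_1 ^ 'd::{finite,linorder} \<Rightarrow> ('d::{finite,linorder} \<Rightarrow>\<^sub>0 nat) \<Rightarrow> 'a" where
  "monom_value a m =
     prod_list (map (\<lambda>i. (a $ i) ^ Poly_Mapping.lookup m i) (sorted_list_of_set UNIV))"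

definition poly_value ::
  "'a::semiring_1 ^ 'd::{finite,linorder} \<Rightarrow> ('d::{finite,linorder}, 'a) mpoly \<Rightarrow> 'a" where
  "poly_value a f = (\<Sum>m\<in>Poly_Mapping.keys f. Poly_Mapping.lookup f m * monom_value a m)"


section \<open>Left ideals\<close>

definition left_ideal :: "'a set \<Rightarrow> ('a, 'm) ring_scheme \<Rightarrow> bool" where
  "left_ideal L R \<longleftrightarrow>
     additive_subgroup L R \<and> (\<forall>r\<in>carrier R. \<forall>x\<in>L. r \<otimes>\<^bsub>R\<^esub> x \<in> L)"

definition semiprime_left_ideal :: "'a set \<Rightarrow> ('a, 'm) ring_scheme \<Rightarrow> bool" where
  "semiprime_left_ideal L R \<longleftrightarrow>
     left_ideal L R \<and>
     (\<forall>a\<in>carrier R. (\<forall>r\<in>carrier R. a \<otimes>\<^bsub>R\<^esub> r \<otimes>\<^bsub>R\<^esub> a \<in> L) \<longrightarrow> a \<in> L)"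

definition semiprime_closure :: "('a, 'm) ring_scheme \<Rightarrow> 'a set \<Rightarrow> 'a set" where
  "semiprime_closure R S = \<Inter> {L. semiprime_left_ideal L R \<and> S \<subseteq> L}"

lemma semiprime_left_ideal_carrier:
  assumes "ring R"
  shows "semiprime_left_ideal (carrier R) R"
proof -
  interpret ring R by fact
  show ?thesis
    unfolding semiprime_left_ideal_def left_ideal_def
    by (auto intro!: additive_subgroupI add.subgroup_self)
qed

lemma semiprime_closure_least:
  assumes "ring R" "S \<subseteq> carrier R"
  shows "semiprime_left_ideal (semiprime_closure R S) R" "S \<subseteq> semiprime_closure R S"
    and "\<And>L. semiprime_left_ideal L R \<Longrightarrow> S \<subseteq> L \<Longrightarrow> semiprime_closure R S \<subseteq> L"
proof -
  interpret ring R by fact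
  let ?F = "{L. semiprime_left_ideal L R \<and> S \<subseteq> L}"
  have ne: "?F \<noteq> {}"
    using semiprime_left_ideal_carrier assms by blast
  have "subgroup (\<Inter> ?F) (add_monoid R)"
    using ne by (intro add.subgroups_Inter)
      (auto simp: semiprime_left_ideal_def left_ideal_def additive_subgroup_def)
  then have "additive_subgroup (\<Inter> ?F) R"
    by (rule additive_subgroupI)
  then show "semiprime_left_ideal (semiprime_closure R S) R"
    unfolding semiprime_closure_def semiprime_left_ideal_def left_ideal_def by blast
qed (auto simp: semiprime_closure_def)

text \<open>The set \<open>L + L a + \<cdots> + L a\<^bsup>N\<^esup>\<close>.\<close>

definition power_span :: "('a, 'm) ring_scheme \<Rightarrow> 'a set \<Rightarrow> 'a \<Rightarrow> nat \<Rightarrow> 'a set" where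
  "power_span R L a N =
     {\<Oplus>\<^bsub>R\<^esub>k\<in>{..N}. g k \<otimes>\<^bsub>R\<^esub> a [^]\<^bsub>R\<^esub> k | g. \<forall>k\<le>N. g k \<in> L}"


section \<open>The two rings\<close>

definition hpoly_ring :: "'d hpoly ring" where
  "hpoly_ring = \<lparr>carrier = UNIV, monoid.mult = (*), one = 1, zero = 0, add = (+)\<rparr>"

text \<open>
  The multiplication on the vector type is componentwise, hence the explicit matrix product.
\<close>

definition cpoly_mat_ring :: "'d cpoly_mat ring" where
  "cpoly_mat_ring = \<lparr>carrier = UNIV, monoid.mult = (**), one = mat 1, zero = 0, add = (+)\<rparr>"

lemma ring_hpoly_ring: "ring hpoly_ring"
  by (intro ringI abelian_groupI monoidI)
     (auto simp: hpoly_ring_def algebra_simps intro: exI[of _ "- x" for x])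

lemma matrix_add_rdistrib:
  fixes A B :: "'a::semiring_1 ^ 'n ^ 'm"
  shows "(A + B) ** C = A ** C + B ** C"
  by (vector matrix_matrix_mult_def sum.distrib[symmetric] distrib_right)

lemma ring_cpoly_mat_ring: "ring cpoly_mat_ring"
  by (intro ringI abelian_groupI monoidI)
     (auto simp: cpoly_mat_ring_def matrix_mul_assoc matrix_add_ldistrib matrix_add_rdistrib
        algebra_simps intro: exI[of _ "- x" for x])


section \<open>The homomorphism into matrices\<close>

definition phi :: "'d hpoly \<Rightarrow> 'd cpoly_mat" where
  "phi f =
     (let p = Poly_Mapping.map cpart f; q = Poly_Mapping.map jpart f in
      vector [vector [p, - Poly_Mapping.map cnj q],
              vector [q, Poly_Mapping.map cnj p]])"

lemma lookup_map_0:
  "g 0 = 0 \<Longrightarrow> Poly_Mapping.lookup (Poly_Mapping.map g f) m = g (Poly_Mapping.lookup f m)"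
  by (simp add: Poly_Mapping.map.rep_eq when_def)

lemma coeff_map_0 [simp]:
  "quat_of_complex 0 = 0" "cpart 0 = 0" "jpart 0 = 0"
  by (simp_all add: quat_eq_iff complex_eq_iff quat_of_complex_def cpart_def jpart_def)

lemma lookup_Const_mult:
  fixes f :: "('d, 'a::semiring_1) mpoly"
  shows "Poly_Mapping.lookup (Const c * f) m = c * Poly_Mapping.lookup f m"
  by (simp add: lookup_map_0 flip: mult_map_scale_conv_mult)

lemma hpoly_decomp_unique:
  "f = Poly_Mapping.map quat_of_complex p + Const quat_j * Poly_Mapping.map quat_of_complex q
     \<longleftrightarrow> p = Poly_Mapping.map cpart f \<and> q = Poly_Mapping.map jpart f"
  unfolding poly_mapping_eq_iff fun_eq_iff
  by (simp add: lookup_add lookup_map_0 lookup_Const_mult quat_decomp_iff all_conj_distrib)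

lemma phi_decomp:
  "phi (Poly_Mapping.map quat_of_complex p + Const quat_j * Poly_Mapping.map quat_of_complex q) =
     vector [vector [p, - Poly_Mapping.map cnj q], vector [q, Poly_Mapping.map cnj p]]"
  using hpoly_decomp_unique[THEN iffD1, OF refl, of p q] by (simp add: phi_def)

lemma phi_add: "phi (f + g) = phi f + phi g"
  unfolding vec_eq_iff forall_2
  by (auto simp: phi_def Let_def lookup_add lookup_minus lookup_uminus lookup_map_0
      cpart_def jpart_def complex_eq_iff
      intro!: poly_mapping_eqI)

lemma phi_single:
  "phi (Poly_Mapping.single m h) =
     vector [vector [Poly_Mapping.single m (cpart h), - Poly_Mapping.single m (cnj (jpart h))],
             vector [Poly_Mapping.single m (jpart h), Poly_Mapping.single m (cnj (cpart h))]]"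
  by (simp add: phi_def)

lemma phi_one: "phi 1 = mat 1"
  unfolding vec_eq_iff forall_2 single_one[symmetric] phi_single
  by (simp add: mat_def cpart_def jpart_def complex_eq_iff flip: one_complex.code zero_complex.code)

lemma phi_mult_single:
  "phi (Poly_Mapping.single m h * Poly_Mapping.single n k) =
     phi (Poly_Mapping.single m h) ** phi (Poly_Mapping.single n k)"
  unfolding vec_eq_iff forall_2
  by (auto simp: phi_single mult_single matrix_matrix_mult_def sum_2 cpart_def jpart_def
      complex_eq_iff lookup_single lookup_add lookup_minus lookup_uminus when_def algebra_simps
      intro!: poly_mapping_eqI)

lemma mpoly_induct [case_names single add]:
  fixes f :: "('d, 'a::comm_monoid_add) mpoly"
  assumes "\<And>m c. P (Poly_Mapping.single m c)" "\<And>f g. P f \<Longrightarrow> P g \<Longrightarrow> P (f + g)"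
  shows "P f"
proof (induction f rule: update_induct)
  case const
  show ?case using assms(1)[of 0 0] by simp
next
  case (update f m c)
  have "Poly_Mapping.update m c f = Poly_Mapping.single m c + f"
    using update by (auto intro!: poly_mapping_eqI
        simp: lookup_update lookup_add lookup_single when_def in_keys_iff)
  then show ?case using assms update by metis
qed

lemma phi_mult: "phi (f * g) = phi f ** phi g"
proof (induction f rule: mpoly_induct)
  case (single m c)
  show ?case
    by (induction g rule: mpoly_induct)
       (simp_all only: phi_mult_single phi_add distrib_left matrix_add_ldistrib)
next
  case (add f1 f2)
  then show ?case
    by (simp add: phi_add distrib_right matrix_add_rdistrib)
qed

definition phi_ideal :: "'d hpoly set \<Rightarrow> 'd cpoly_mat set" where
  "phi_ideal I = {phi u + map_matrix (\<lambda>p. Const \<i> * p) (phi v) | u v. u \<in> I \<and> v \<in> I}"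


section \<open>Radicals\<close>

definition commuting_points :: "(quat ^ 'd::finite) set" where
  "commuting_points = {a. \<forall>i j. a $ i * a $ j = a $ j * a $ i}"

definition hpoly_radical :: "'d::{finite,linorder} hpoly set \<Rightarrow> 'd hpoly set" where
  "hpoly_radical I =
     {f. \<forall>a\<in>commuting_points. (\<forall>g\<in>I. poly_value a g = 0) \<longrightarrow> poly_value a f = 0}"

definition mat_value ::
  "complex ^ 'd::{finite,linorder} \<Rightarrow> 'd::{finite,linorder} cpoly_mat \<Rightarrow> complex ^ 2 ^ 2" where
  "mat_value c F = map_matrix (poly_value c) F"

definition cpoly_mat_radical :: "'d::{finite,linorder} cpoly_mat set \<Rightarrow> 'd cpoly_mat set" where
  "cpoly_mat_radical L =
     {F. \<forall>c w. w \<noteq> 0 \<longrightarrow> (\<forall>G\<in>L. mat_value c G *v w = 0) \<longrightarrow> mat_value c F *v w = 0}"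

end

theory Submission
  imports Defs "HOL-Computational_Algebra.Fundamental_Theorem_Algebra"
begin

text \<open>
  The zeros of \<open>I\<close> and those of \<open>phi_ideal I\<close> are the same.  Commuting quaternions lie in a common copy
  of the complex numbers, so a commuting point has the form \<open>a\<^sub>i = h c\<^sub>i h\<^sup>-\<^sup>1\<close> with a complex point \<open>c\<close>, and
  \<open>f(a) h\<close> is the quaternion whose complex coordinates are \<open>phi f\<close> at \<open>c\<close> applied to those of \<open>h\<close>
  (\<open>quat_vec_poly_value\<close>).  This is the equivalence of (1) and (2), \<open>hpoly_radical_iff\<close>.

  The other conditions are linked by the cycles (2), (5), (6), (2) and (1), (4), (3), (2).

  The step from (2) to (5) is a Nullstellensatz for left ideals of \<open>2 \<times> 2\<close> matrices over
  the complex polynomials, \<open>matrix_nullstellensatz\<close>.  If no power of \<open>F\<close> lies in \<open>L + L F + L F\<^sup>2 + \<dots>\<close>, take a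
  left ideal \<open>P\<close> above it that is maximal among those stable under right multiplication by \<open>F\<close> and
  free of powers of \<open>F\<close>.  Central elements modulo \<open>P\<close> form an integral domain, and because the complex
  field is uncountable while the matrix ring has countable dimension, each variable is congruent
  to a scalar modulo \<open>P\<close> (\<open>maximal_avoiding_residue\<close>).  So everything happens at a single point, where plane
  linear algebra produces a vector annihilated by \<open>L\<close> and not by \<open>F\<close>.  Every matrix is uniquely
  \<open>phi u + \<i> phi v\<close>, so for the matrix \<open>A\<close> of a quaternion \<open>b\<close> condition (5) restricts
  to (6).  From (6) back to (2): at a zero
  \<open>w\<close> of \<open>I\<close> where \<open>f\<close> does not vanish, some quaternion \<open>b\<close> makes \<open>w\<close> a fixed vector of \<open>b f\<close>, which is
  incompatible with the relation in (6).

  For (1) to (4), let \<open>J\<close> be a semiprime left ideal containing \<open>I\<close>.  All elements of its radical satisfy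
  the power condition over \<open>J\<close>, by the Nullstellensatz just described.  A purely algebraic
  argument, \<open>semiprime_lideal_power_closed\<close>, shows that \<open>J\<close> then equals its radical; it uses only
  an involution whose traces \<open>x + x\<^sup>*\<close> and norms \<open>x\<^sup>* x\<close> are central.  (4) implies (3) because
  preimages of semiprime left ideals under \<open>phi\<close> are semiprime, and (3) implies (2) because the radical of a left ideal of
  matrices is itself semiprime.
\<close>

section \<open>Semiprime left ideals in rings with central traces and norms\<close>

definition central :: "'a::ring_1 \<Rightarrow> bool" where
  "central s \<longleftrightarrow> (\<forall>y. s * y = y * s)"

lemma centralD: "central s \<Longrightarrow> s * y = y * s"
  by (simp add: central_def)

lemma central_mult: "central s \<Longrightarrow> central t \<Longrightarrow> central (s * t)"
  unfolding central_def by (metis mult.assoc)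

lemma central_power: "central s \<Longrightarrow> central (s ^ n)"
  by (induction n) (auto intro: central_mult simp: central_def[of 1])

definition lideal :: "'a::ring_1 set \<Rightarrow> bool" where
  "lideal L \<longleftrightarrow> 0 \<in> L \<and> (\<forall>x\<in>L. \<forall>y\<in>L. x + y \<in> L) \<and> (\<forall>r. \<forall>x\<in>L. r * x \<in> L)"

lemma lidealD:
  assumes "lideal L"
  shows "0 \<in> L" and "x \<in> L \<Longrightarrow> y \<in> L \<Longrightarrow> x + y \<in> L" and "x \<in> L \<Longrightarrow> r * x \<in> L"
    and "x \<in> L \<Longrightarrow> y \<in> L \<Longrightarrow> x - y \<in> L"
proof -
  show add: "x + y \<in> L" if "x \<in> L" "y \<in> L" for x y
    using assms that by (auto simp: lideal_def)
  show mult: "r * x \<in> L" if "x \<in> L" for r x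
    using assms that by (auto simp: lideal_def)
  show "x - y \<in> L" if "x \<in> L" "y \<in> L"
    using add[OF that(1) mult[OF that(2), of "-1"]] by simp
qed (use assms in \<open>auto simp: lideal_def\<close>)

lemma lideal_cong_diff:
  assumes "lideal L" "x - y \<in> L"
  shows "x \<in> L \<longleftrightarrow> y \<in> L"
  using lidealD(2)[OF assms(1) assms(2), of y] lidealD(4)[OF assms(1) _ assms(2), of x] by auto

lemma lideal_sum: "lideal L \<Longrightarrow> (\<And>k. k \<in> A \<Longrightarrow> g k \<in> L) \<Longrightarrow> sum g A \<in> L"
  by (induction A rule: infinite_finite_induct) (auto intro: lidealD)

text \<open>
  What the arguments below use of a ring of quaternionic polynomials: conjugation is an involution
  whose traces and norms are central.
\<close>

locale trace_involution =
  fixes cj :: "'a::ring_1 \<Rightarrow> 'a"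
  assumes cj_mult: "cj (x * y) = cj y * cj x"
    and cj_cj: "cj (cj x) = x"
    and central_trace: "central (x + cj x)"
    and central_norm: "central (cj x * x)"
begin

lemma cj_commute: "x * cj x = cj x * x"
  using centralD[OF central_trace, of x x] by (simp add: algebra_simps)

text \<open>
  The Cayley--Hamilton equation for the trace \<open>x + x\<^sup>*\<close> and the norm \<open>x\<^sup>* x\<close>, and a variant of it obtained
  by writing the factor \<open>y x\<close> of \<open>x y x\<close> as its trace minus its conjugate.  The variant makes \<open>x y x\<close> a
  central multiple of \<open>x\<close> modulo every left ideal containing the norm of \<open>x\<close>.
\<close>

lemma square_eq: "x * x = (x + cj x) * x - cj x * x"
  by (simp add: algebra_simps)

lemma sandwich_eq: "x * y * x = (y * x + cj (y * x)) * x - cj y * (cj x * x)"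
proof -
  have "x * y * x = x * (y * x + cj (y * x)) - x * cj x * cj y"
    by (simp add: cj_mult algebra_simps)
  also have "x * cj x * cj y = cj y * (cj x * x)"
    unfolding cj_commute by (rule centralD[OF central_norm])
  finally show ?thesis
    by (simp only: centralD[OF central_trace])
qed

text \<open>
  The passage from the power condition to semiprimeness.  It proceeds from special elements of \<open>S\<close>
  to general ones.  For a central element the power condition is a membership of a power, so
  semiprimeness applies at once; in particular every norm from \<open>S\<close> lies in \<open>J\<close>.  Next, traces of
  elements of \<open>J\<close> multiply \<open>S\<close> into \<open>J\<close>.  Modulo \<open>J\<close> every \<open>g\<close> in \<open>S\<close> then satisfies \<open>g\<^sup>2 = t g\<close> with
  \<open>t = tr g\<close>, and the power condition for \<open>g\<close> collapses to \<open>t\<^sup>k g = 0\<close> for some \<open>k\<close>.  Applied to \<open>g = r f\<close>,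
  and multiplied by \<open>f\<close> from the left,
  this says that a power of \<open>tr (r f)\<close> carries \<open>f\<close> into \<open>J\<close>; semiprimeness lowers the exponent to 1, and
  since \<open>f r f\<close> is congruent to \<open>tr (r f) f\<close>, a last use of semiprimeness gives \<open>f \<in> J\<close>.
\<close>

theorem semiprime_lideal_power_closed:
  fixes J S :: "'a set"
  assumes J: "lideal J"
    and semiprime: "\<And>a. (\<And>r. a * r * a \<in> J) \<Longrightarrow> a \<in> J"
    and S: "lideal S" and JS: "J \<subseteq> S"
    and integral: "\<And>g. g \<in> S \<Longrightarrow>
      \<exists>N u. (\<forall>k\<le>N. u k \<in> J) \<and> g ^ N = (\<Sum>k\<le>N. u k * g ^ k)"
  shows "S = J"
proof
  note J_simps = lidealD[OF J] and S_simps = lidealD[OF S]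
  have central_right: "x * s \<in> J" if "central s" "x \<in> J" for s x
    using J_simps(3)[OF that(2), of s] centralD[OF that(1)] by simp
  have central_left: "s * x \<in> J" if "central s" "s \<in> J" for s x
    using J_simps(3)[OF that(2), of x] centralD[OF that(1)] by simp

  have central_mem: "s \<in> J" if c: "central s" and "s \<in> S" for s
  proof -
    obtain N u where u: "\<forall>k\<le>N. u k \<in> J" "s ^ N = (\<Sum>k\<le>N. u k * s ^ k)"
      using integral[OF \<open>s \<in> S\<close>] by blast
    have "s ^ N \<in> J"
      unfolding u(2) using u(1) by (auto intro!: lideal_sum[OF J] central_right central_power c)
    moreover have "s ^ Suc m \<in> J" if "s ^ Suc (Suc m) \<in> J" for m
    proof (rule semiprime)
      fix r
      have "s ^ Suc m * r * s ^ Suc m = r * (s ^ Suc m * s ^ Suc m)"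
        using centralD[OF central_power[OF c]] by (metis mult.assoc)
      also have "s ^ Suc m * s ^ Suc m = s ^ m * s ^ Suc (Suc m)"
        by (simp only: flip: power_add) simp
      finally show "s ^ Suc m * r * s ^ Suc m \<in> J"
        using J_simps(3) that by metis
    qed
    ultimately show ?thesis
    proof (induction N)
      case 0
      then show ?case using J_simps(3)[of 1 s] by simp
    next
      case (Suc N)
      then show ?case by (cases N) auto
    qed
  qed
  have norm_mem: "cj f * f \<in> J" if "f \<in> S" for f :: 'a
    using central_mem[OF central_norm] S_simps(3)[OF that] by blast

  \<comment> \<open>With \<open>w = v\<^sup>*\<close> the element \<open>f w\<close> is congruent to \<open>tr v \<cdot> f\<close> modulo \<open>J\<close>, so it suffices to put \<open>f w\<close> into \<open>J\<close>
    by semiprimeness.  As the norm of \<open>w\<close> is in \<open>J\<close>, the factor \<open>w r f w\<close> is modulo \<open>J\<close> a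
    central multiple \<open>s w\<close> of \<open>w\<close>; it lies in \<open>S\<close>, whence the central element \<open>s \<cdot> tr v\<close> lies in \<open>S\<close> and so in \<open>J\<close>.\<close>
  have trace_kills: "(v + cj v) * f \<in> J" if v: "v \<in> J" and f: "f \<in> S" for v f :: 'a
  proof -
    define w where "w = cj v"
    define t where "t = v + cj v"
    have ct: "central t" unfolding t_def by (rule central_trace)
    have fw: "f * w = t * f - f * v"
      using centralD[OF ct, of f] unfolding t_def w_def by (simp add: algebra_simps)
    have fv: "f * v \<in> J" by (rule J_simps(3)[OF v])
    have fwS: "f * w \<in> S"
      unfolding fw using fv JS f by (auto intro: S_simps)
    have "f * w \<in> J"
    proof (rule semiprime)
      fix r
      define s where "s = (r * f) * w + cj ((r * f) * w)"
      define e where "e = cj (r * f) * (cj w * w)"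
      have cs: "central s" unfolding s_def by (rule central_trace)
      have nw: "cj w * w \<in> J"
        unfolding w_def cj_cj cj_commute by (rule J_simps(3)[OF v])
      then have e: "e \<in> J" unfolding e_def by (rule J_simps(3))
      have wrw: "w * (r * f) * w = s * w - e"
        unfolding s_def e_def by (rule sandwich_eq)
      have sw: "s * w = s * t - s * v"
        unfolding w_def t_def by (simp add: algebra_simps)
      have "s * t = w * r * (f * w) + e + s * v"
        using wrw sw by (simp add: algebra_simps)
      also have "\<dots> \<in> S"
        by (intro S_simps(2) S_simps(3)[OF fwS] subsetD[OF JS] e J_simps(3)[OF v])
      finally have st: "s * t \<in> J"
        by (rule central_mem[OF central_mult[OF cs ct]])
      have "(f * w) * r * (f * w) = f * (w * (r * f) * w)"
        by (simp add: mult.assoc)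
      also have "\<dots> = f * (s * t) - f * (s * v) - f * e"
        unfolding wrw sw by (simp add: algebra_simps)
      also have "\<dots> \<in> J"
        by (intro J_simps(3,4) st v e)
      finally show "(f * w) * r * (f * w) \<in> J" .
    qed
    then show ?thesis
      using J_simps(2)[OF _ fv, of "f * w"] unfolding fw t_def by simp
  qed

  have trace_power: "\<exists>k. (g + cj g) ^ k * g \<in> J" if g: "g \<in> S" for g :: 'a
  proof -
    define t where "t = g + cj g"
    define n where "n = cj g * g"
    have ct: "central t" and cn: "central n" and n: "n \<in> J"
      unfolding t_def n_def using central_trace central_norm norm_mem[OF g] by auto
    \<comment> \<open>Powers of \<open>g\<close> on the right collapse, since \<open>g\<^sup>2 = t g - n\<close> and \<open>n\<close> is central in \<open>J\<close>.\<close>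
    have red: "x * g ^ Suc k - t ^ k * x * g \<in> J" for x k
    proof (induction k)
      case (Suc k)
      have gg: "g * g = t * g - n" unfolding t_def n_def by (rule square_eq)
      have "x * g ^ Suc (Suc k) = x * g ^ k * (g * g)"
        by (simp only: power_Suc2 mult.assoc)
      also have "\<dots> = t * (x * g ^ Suc k) - x * g ^ k * n"
        unfolding gg right_diff_distrib
        using centralD[OF ct, of "x * g ^ k"] by (metis mult.assoc power_Suc2)
      finally have "x * g ^ Suc (Suc k) - t ^ Suc k * x * g =
          t * (x * g ^ Suc k - t ^ k * x * g) - x * g ^ k * n"
        by (simp add: right_diff_distrib mult.assoc)
      also have "\<dots> \<in> J" by (intro J_simps(3,4) Suc n)
      finally show ?case .
    qed (use J_simps in simp)
    \<comment> \<open>The relation is multiplied by \<open>g\<close> once more, so that also its term of exponent 0 can be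
      collapsed.  It becomes \<open>t\<^sup>N g = v g\<close> modulo \<open>J\<close> with \<open>v \<in> J\<close>; multiplying by \<open>v\<^sup>*\<close> and using
      that \<open>tr v\<close> carries \<open>g\<close> into \<open>J\<close> eliminates \<open>v\<close>.\<close>
    obtain N u where u: "\<And>k. k \<le> N \<Longrightarrow> u k \<in> J" and gN: "g ^ N = (\<Sum>k\<le>N. u k * g ^ k)"
      using integral[OF g] by blast
    define v where "v = (\<Sum>k\<le>N. t ^ k * u k)"
    have v: "v \<in> J" unfolding v_def using u by (intro lideal_sum[OF J] J_simps(3)) auto
    have "(\<Sum>k\<le>N. u k * g ^ Suc k - t ^ k * u k * g) \<in> J"
      by (intro lideal_sum[OF J] red)
    also have "(\<Sum>k\<le>N. u k * g ^ Suc k - t ^ k * u k * g) = g ^ Suc N - v * g"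
      unfolding v_def sum_subtractf sum_distrib_right power_Suc2 gN by (simp add: mult.assoc)
    finally have 1: "g ^ Suc N - v * g \<in> J" .
    have d: "t ^ N * g - v * g \<in> J"
      using J_simps(4)[OF 1 red[of 1 N]] by simp
    have "cj v * v * g \<in> J"
      by (intro central_left central_norm J_simps(3) v)
    then have "cj v * (t ^ N * g - v * g) + cj v * v * g \<in> J"
      by (rule J_simps(2)[OF J_simps(3)[OF d]])
    also have "cj v * (t ^ N * g - v * g) + cj v * v * g = t ^ N * (cj v * g)"
      using centralD[OF central_power[OF ct], of N "cj v"]
      by (simp add: right_diff_distrib flip: mult.assoc)
    finally have 2: "t ^ N * (cj v * g) \<in> J" .
    have 3: "t ^ N * (v * g) + t ^ N * (cj v * g) \<in> J"
      using J_simps(3)[OF trace_kills[OF v g], of "t ^ N"]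
      by (simp only: distrib_left distrib_right)
    have "t ^ N * (v * g) \<in> J"
      using J_simps(4)[OF 3 2] by simp
    then have "t ^ N * (t ^ N * g) \<in> J"
      using lideal_cong_diff[OF J] J_simps(3)[OF d, of "t ^ N"]
      by (simp only: right_diff_distrib)
    then show ?thesis
      unfolding t_def by (metis mult.assoc power_add)
  qed

  show "S \<subseteq> J"
  proof
    fix f assume f: "f \<in> S"
    define t where "t r = r * f + cj (r * f)" for r
    have ct: "central (t r)" for r
      unfolding t_def by (rule central_trace)
    have ctp: "central (t r ^ k)" for r k
      by (rule central_power[OF ct])
    have frf: "f * r * f - t r * f \<in> J" for r
    proof -
      have "f * r * f - t r * f = (-1 * cj r) * (cj f * f)"
        unfolding sandwich_eq t_def by simp
      then show ?thesis using J_simps(3)[OF norm_mem[OF f]] by metis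
    qed
    have trace_mem: "t r * f \<in> J" for r
    proof -
      obtain k where k: "t r ^ k * (r * f) \<in> J"
        using trace_power[OF S_simps(3)[OF f]] unfolding t_def by blast
      have "f * (t r ^ k * (r * f)) = t r ^ k * (f * r * f)"
        using centralD[OF ctp, of r k f] by (metis mult.assoc)
      then have "t r ^ k * (f * r * f) \<in> J"
        using J_simps(3)[OF k] by metis
      then have "t r ^ k * (t r * f) \<in> J"
        using lideal_cong_diff[OF J] J_simps(3)[OF frf] by (metis right_diff_distrib)
      then have "t r ^ Suc k * f \<in> J"
        by (simp only: power_Suc2 mult.assoc)
      \<comment> \<open>The square of \<open>t\<^sup>i\<^sup>+\<^sup>1\<close> contains the factor \<open>t\<^sup>i\<^sup>+\<^sup>2\<close>, which already carries \<open>f\<close> into \<open>J\<close>.\<close>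
      moreover have "t r ^ Suc i * f \<in> J" if i: "t r ^ Suc (Suc i) * f \<in> J" for i
      proof (rule semiprime)
        fix q
        define s where "s = t r ^ Suc i"
        have cs: "central s" unfolding s_def by (rule ctp)
        have "(s * f) * q * (s * f) = s * s * (f * q * f)"
          using centralD[OF cs, of "f * q"] by (metis mult.assoc)
        moreover have "s * s * (t q * f) \<in> J"
        proof -
          have "s * s = t r ^ i * t r ^ Suc (Suc i)"
            unfolding s_def by (simp only: flip: power_add) simp
          then have "s * s * (t q * f) = t r ^ i * (t q * (t r ^ Suc (Suc i) * f))"
            using centralD[OF ctp] by (metis mult.assoc)
          then show ?thesis using J_simps(3) i by metis
        qed
        ultimately have "(s * f) * q * (s * f) \<in> J"
          using lideal_cong_diff[OF J] J_simps(3)[OF frf] by (metis right_diff_distrib)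
        then show "t r ^ Suc i * f * q * (t r ^ Suc i * f) \<in> J" unfolding s_def .
      qed
      ultimately have "t r ^ Suc 0 * f \<in> J"
        by (induction k) auto
      then show ?thesis by simp
    qed
    show "f \<in> J"
      using semiprime lideal_cong_diff[OF J frf] trace_mem by blast
  qed
qed (fact JS)

end

section \<open>Left ideals of matrix rings\<close>

definition mat_lideal :: "('a::ring_1 ^ 'n ^ 'n) set \<Rightarrow> bool" where
  "mat_lideal P \<longleftrightarrow> 0 \<in> P \<and> (\<forall>x\<in>P. \<forall>y\<in>P. x + y \<in> P) \<and> (\<forall>M. \<forall>x\<in>P. M ** x \<in> P)"

lemma mat_lidealD:
  assumes "mat_lideal P"
  shows "0 \<in> P" and "x \<in> P \<Longrightarrow> y \<in> P \<Longrightarrow> x + y \<in> P" and "x \<in> P \<Longrightarrow> M ** x \<in> P"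
    and "x \<in> P \<Longrightarrow> y \<in> P \<Longrightarrow> x - y \<in> P"
proof -
  show add: "x + y \<in> P" if "x \<in> P" "y \<in> P" for x y
    using assms that by (auto simp: mat_lideal_def)
  show mult: "M ** x \<in> P" if "x \<in> P" for M x
    using assms that by (auto simp: mat_lideal_def)
  have "mat (-1) ** y = - y" for y :: "'a ^ 'b ^ 'b"
    by (simp add: vec_eq_iff matrix_matrix_mult_def mat_def if_distrib if_distribR sum.delta cong: if_cong)
  then show "x - y \<in> P" if "x \<in> P" "y \<in> P"
    using add[OF that(1) mult[OF that(2), of "mat (-1)"]] by simp
qed (use assms in \<open>auto simp: mat_lideal_def\<close>)

lemma mat_lideal_sum: "mat_lideal P \<Longrightarrow> (\<And>k. k \<in> A \<Longrightarrow> g k \<in> P) \<Longrightarrow> sum g A \<in> P"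
  by (induction A rule: infinite_finite_induct) (auto intro: mat_lidealD)

lemma matrix_sum_ldistrib:
  fixes g :: "'b \<Rightarrow> 'a::ring_1 ^ 'n ^ 'n"
  shows "M ** sum g A = (\<Sum>k\<in>A. M ** g k)"
  by (induction A rule: infinite_finite_induct) (auto simp: matrix_add_ldistrib)

lemma matrix_sum_rdistrib:
  fixes g :: "'b \<Rightarrow> 'a::ring_1 ^ 'n ^ 'n"
  shows "sum g A ** M = (\<Sum>k\<in>A. g k ** M)"
  by (induction A rule: infinite_finite_induct) (auto simp: matrix_add_rdistrib)

lemma nth_mat_mult: "(mat p ** M) $ i $ j = p * M $ i $ j"
  by (simp add: matrix_matrix_mult_def mat_def if_distrib if_distribR sum.delta cong: if_cong)

lemma mat_commute:
  fixes M :: "'a::comm_ring_1 ^ 'n ^ 'n"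
  shows "M ** mat p = mat p ** M"
  by (simp add: vec_eq_iff nth_mat_mult)
     (simp add: matrix_matrix_mult_def mat_def if_distrib if_distribR sum.delta mult.commute cong: if_cong)

lemma mat_mult: "mat p ** mat q = mat (p * q)"
  by (simp add: vec_eq_iff nth_mat_mult) (simp add: mat_def)

lemma mat_add: "mat p + mat q = mat (p + q :: 'a::ring_1)"
  by (simp add: vec_eq_iff) (simp add: mat_def)

lemma mat_sum: "(\<Sum>k\<in>A. mat (p k :: 'a::ring_1)) = mat (sum p A)"
  by (induction A rule: infinite_finite_induct) (auto simp: mat_add)

definition matrix_unit :: "'n \<Rightarrow> 'n \<Rightarrow> 'a::ring_1 ^ 'n ^ 'n" where
  "matrix_unit k l = (\<chi> i j. if i = k \<and> j = l then 1 else 0)"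

lemma nth_matrix_unit_mult:
  "(matrix_unit k l ** M) $ i $ j = (if i = k then M $ l $ j else 0)"
  by (simp add: matrix_matrix_mult_def matrix_unit_def if_distrib if_distribR sum.delta
      of_bool_def[symmetric] flip: of_bool_conj)

lemma mat_lideal_entries:
  fixes P :: "('a::comm_ring_1 ^ 'n::finite ^ 'n) set"
  assumes P: "mat_lideal P" and M: "\<And>i j. mat (M $ i $ j) \<in> P"
  shows "M \<in> P"
proof -
  have inner: "(\<Sum>l\<in>UNIV. M $ k $ l * (if i = k \<and> j = l then 1 else 0)) = (if i = k then M $ k $ j else 0)"
    for i j k
    by (cases "i = k") (simp_all add: if_distrib sum.delta cong: if_cong)
  have "M = (\<Sum>k\<in>UNIV. \<Sum>l\<in>UNIV. matrix_unit k l ** mat (M $ k $ l))"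
    unfolding mat_commute by (simp add: vec_eq_iff nth_mat_mult matrix_unit_def inner)
  also have "\<dots> \<in> P"
    by (intro mat_lideal_sum[OF P] mat_lidealD(3)[OF P] M)
  finally show ?thesis .
qed

lemma matrix_diff_ldistrib:
  fixes A :: "'a::ring_1 ^ 'n ^ 'm"
  shows "A ** (B - C) = A ** B - A ** C"
  using matrix_add_ldistrib[of A "B - C" C] by (simp add: algebra_simps)

lemma matrix_diff_rdistrib:
  fixes A :: "'a::ring_1 ^ 'n ^ 'm"
  shows "(A - B) ** C = A ** C - B ** C"
  using matrix_add_rdistrib[of "A - B" B C] by (simp add: algebra_simps)

lemma mat_left_commute:
  fixes M G :: "'a::comm_ring_1 ^ 'n ^ 'n"
  shows "mat p ** (M ** G) = M ** (mat p ** G)"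
  by (simp only: matrix_mul_assoc mat_commute[of M p])

lemma mat_lideal_cong_diff:
  assumes "mat_lideal L" "x - y \<in> L"
  shows "x \<in> L \<longleftrightarrow> y \<in> L"
  using mat_lidealD(2)[OF assms(1) assms(2), of y] mat_lidealD(4)[OF assms(1) _ assms(2), of x]
  by auto

text \<open>
  A subspace of the plane and a vector outside it are separated by a linear form: if some \<open>u\<close> of
  the subspace is not parallel to \<open>r\<close>, the form is the determinant against \<open>u\<close>; otherwise the
  subspace is zero.
\<close>

lemma separate_line:
  fixes U :: "('a::field ^ 2) set"
  assumes zero: "0 \<in> U" and add: "\<And>u v. u \<in> U \<Longrightarrow> v \<in> U \<Longrightarrow> u + v \<in> U"
    and scale: "\<And>a u. u \<in> U \<Longrightarrow> a *s u \<in> U" and r: "r \<notin> U"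
  obtains w :: "'a ^ 2" where "\<And>u. u \<in> U \<Longrightarrow> u $ 1 * w $ 1 + u $ 2 * w $ 2 = 0"
    and "r $ 1 * w $ 1 + r $ 2 * w $ 2 \<noteq> 0"
proof (cases "\<exists>u\<in>U. r $ 1 * u $ 2 \<noteq> r $ 2 * u $ 1")
  case True
  then obtain u where u: "u \<in> U" and ne: "r $ 1 * u $ 2 - r $ 2 * u $ 1 \<noteq> 0" by auto
  have "u' $ 1 * u $ 2 - u' $ 2 * u $ 1 = 0" if "u' \<in> U" for u'
  proof (rule ccontr)
    define d where "d = u' $ 1 * u $ 2 - u' $ 2 * u $ 1"
    assume "u' $ 1 * u $ 2 - u' $ 2 * u $ 1 \<noteq> 0"
    then have d: "d \<noteq> 0" by (simp add: d_def)
    have "r = ((r $ 2 * u' $ 1 - r $ 1 * u' $ 2) / d) *s u + ((r $ 1 * u $ 2 - r $ 2 * u $ 1) / d) *s u'"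
      using d unfolding vec_eq_iff forall_2 by (simp add: field_simps) (simp add: d_def algebra_simps)
    then show False using r add scale u that by metis
  qed
  then show ?thesis
    using that[of "vector [u $ 2, - (u $ 1)]"] ne by simp
next
  case False
  have "u = 0" if u: "u \<in> U" for u
  proof (rule ccontr)
    assume "u \<noteq> 0"
    then consider "u $ 1 \<noteq> 0" | "u $ 2 \<noteq> 0"
      unfolding vec_eq_iff forall_2 by auto
    then show False
    proof cases
      case 1
      then have "r = (r $ 1 / u $ 1) *s u"
        using False u unfolding vec_eq_iff forall_2 by (auto simp: field_simps)
      then show False using r scale u by metis
    next
      case 2
      then have "r = (r $ 2 / u $ 2) *s u"
        using False u unfolding vec_eq_iff forall_2 by (auto simp: field_simps)
      then show False using r scale u by metis
    qed
  qed
  moreover have "r $ 1 \<noteq> 0 \<or> r $ 2 \<noteq> 0"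
    using r zero unfolding vec_eq_iff forall_2 by (metis (no_types) exhaust_2 vec_eq_iff zero_index)
  ultimately show ?thesis
    using that[of "vector [1, 0]"] that[of "vector [0, 1]"] by force
qed

text \<open>
  Membership in a left ideal of matrices depends on the rows only: the ideal consists of all matrices
  whose rows lie in a fixed subspace \<open>U\<close>.  So a row outside \<open>U\<close> can be separated.
\<close>

lemma mat_lideal_separate:
  fixes P :: "('a::field ^ 2 ^ 2) set"
  assumes P: "mat_lideal P" and M: "M \<notin> P"
  obtains w where "\<And>G. G \<in> P \<Longrightarrow> G *v w = 0" and "M *v w \<noteq> 0"
proof -
  define R :: "2 \<Rightarrow> 'a ^ 2 \<Rightarrow> 'a ^ 2 ^ 2" where "R k v = (\<chi> i. if i = k then v else 0)" for k v
  define U where "U = {v. \<forall>k. R k v \<in> P}"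
  have row: "G $ l \<in> U" if "G \<in> P" for G l
  proof -
    have "R k (G $ l) = matrix_unit k l ** G" for k
      by (simp add: vec_eq_iff R_def nth_matrix_unit_mult)
    then show ?thesis unfolding U_def using mat_lidealD(3)[OF P that] by simp
  qed
  have "\<exists>l. M $ l \<notin> U"
  proof (rule ccontr)
    assume "\<nexists>l. M $ l \<notin> U"
    then have "(\<Sum>l\<in>UNIV. R l (M $ l)) \<in> P"
      by (intro mat_lideal_sum[OF P]) (auto simp: U_def)
    also have "(\<Sum>l\<in>UNIV. R l (M $ l)) = M"
      by (simp add: vec_eq_iff R_def sum_2 forall_2)
    finally show False using M by simp
  qed
  then obtain l where l: "M $ l \<notin> U" ..
  have zero: "0 \<in> U"
  proof -
    have "R k 0 = 0" for k by (simp add: R_def vec_eq_iff)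
    then show ?thesis using mat_lidealD(1)[OF P] by (simp add: U_def)
  qed
  have add: "u + v \<in> U" if "u \<in> U" "v \<in> U" for u v
  proof -
    have "R k (u + v) = R k u + R k v" for k by (simp add: R_def vec_eq_iff)
    then show ?thesis using that mat_lidealD(2)[OF P] by (simp add: U_def)
  qed
  have scale: "a *s u \<in> U" if "u \<in> U" for a u
  proof -
    have "R k (a *s u) = mat a ** R k u" for k by (simp add: vec_eq_iff nth_mat_mult) (simp add: R_def)
    then show ?thesis using that mat_lidealD(3)[OF P] by (simp add: U_def)
  qed
  obtain w :: "'a ^ 2" where w: "\<And>u. u \<in> U \<Longrightarrow> u $ 1 * w $ 1 + u $ 2 * w $ 2 = 0"
    "M $ l $ 1 * w $ 1 + M $ l $ 2 * w $ 2 \<noteq> 0"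
    using separate_line[OF zero add scale l] by blast
  show ?thesis
  proof
    show "G *v w = 0" if "G \<in> P" for G
      using w(1)[OF row[OF that]] by (simp add: vec_eq_iff matrix_vector_mult_def sum_2)
    have "(M *v w) $ l \<noteq> 0" using w(2) by (simp add: matrix_vector_mult_def sum_2)
    then show "M *v w \<noteq> 0" by (metis zero_index)
  qed
qed

section \<open>Evaluation of polynomials and matrices\<close>

lemma poly_value_superset:
  assumes "finite K" "Poly_Mapping.keys f \<subseteq> K"
  shows "poly_value a f = (\<Sum>m\<in>K. Poly_Mapping.lookup f m * monom_value a m)"
  unfolding poly_value_def using assms
  by (intro sum.mono_neutral_left) (auto simp: in_keys_iff)

lemma poly_value_add: "poly_value a (f + g) = poly_value a f + poly_value a g"
proof -
  let ?K = "Poly_Mapping.keys f \<union> Poly_Mapping.keys g"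
  have "poly_value a (f + g) = (\<Sum>m\<in>?K. Poly_Mapping.lookup (f + g) m * monom_value a m)"
    by (intro poly_value_superset keys_add) auto
  also have "\<dots> = poly_value a f + poly_value a g"
    by (subst (1 2) poly_value_superset[of ?K]) (auto simp: lookup_add distrib_right sum.distrib)
  finally show ?thesis .
qed

lemma poly_value_0 [simp]: "poly_value a 0 = 0"
  by (simp add: poly_value_def)

lemma poly_value_single: "poly_value a (Poly_Mapping.single m c) = c * monom_value a m"
  by (subst poly_value_superset[of "{m}"]) auto

lemma monom_value_zero [simp]: "monom_value a 0 = 1"
proof -
  have "prod_list (map (\<lambda>i. 1) xs) = (1 :: 'a)" for xs :: "'b list" by (induction xs) auto
  then show ?thesis by (simp add: monom_value_def)
qed

lemma poly_value_Const [simp]: "poly_value a (Const c) = c"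
  by (simp add: poly_value_single)

lemma monom_value_prod:
  fixes a :: "'a::comm_semiring_1 ^ 'd::{finite,linorder}"
  shows "monom_value a m = (\<Prod>i\<in>UNIV. a $ i ^ Poly_Mapping.lookup m i)"
  unfolding monom_value_def by (subst prod.distinct_set_conv_list[symmetric]) auto

lemma monom_value_add:
  fixes a :: "'a::comm_semiring_1 ^ 'd::{finite,linorder}"
  shows "monom_value a (m + n) = monom_value a m * monom_value a n"
  by (simp add: monom_value_prod lookup_add power_add prod.distrib)

lemma poly_value_mult:
  fixes a :: "'a::comm_semiring_1 ^ 'd::{finite,linorder}"
  shows "poly_value a (f * g) = poly_value a f * poly_value a g"
proof (induction f rule: mpoly_induct)
  case (single m c)
  show ?case
  proof (induction g rule: mpoly_induct)
    case (single n b)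
    show ?case by (simp add: mult_single poly_value_single monom_value_add mult_ac)
  next
    case (add g h)
    then show ?case by (simp add: distrib_left poly_value_add)
  qed
qed (simp add: poly_value_add distrib_right)

lemma mat_value_mult: "mat_value c (F ** G) = mat_value c F ** mat_value c G"
  by (simp add: mat_value_def vec_eq_iff matrix_matrix_mult_def sum_2 poly_value_add poly_value_mult)

lemma mat_value_add: "mat_value c (F + G) = mat_value c F + mat_value c G"
  by (simp add: mat_value_def vec_eq_iff poly_value_add)

lemma mat_value_0 [simp]: "mat_value c 0 = 0"
  by (simp add: mat_value_def vec_eq_iff)

lemma mat_value_Const [simp]: "mat_value c (map_matrix Const A) = A"
  by (simp add: mat_value_def vec_eq_iff)

lemma map_matrix_Const_1: "map_matrix Const (mat 1) = mat 1"
  by (simp add: vec_eq_iff mat_def)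

lemma mat_value_1 [simp]: "mat_value c (mat 1) = mat 1"
  using mat_value_Const[of c "mat 1"] unfolding map_matrix_Const_1 .

lemma map_matrix_Const_mult:
  fixes A B :: "'a::comm_ring_1 ^ 2 ^ 2"
  shows "map_matrix Const (A ** B) = (map_matrix Const A ** map_matrix Const B :: ('d, 'a) mpoly ^ 2 ^ 2)"
  by (simp add: vec_eq_iff matrix_matrix_mult_def sum_2 single_add mult_single)

lemma map_matrix_Const_add:
  fixes A B :: "'a::comm_ring_1 ^ 2 ^ 2"
  shows "map_matrix Const (A + B) = (map_matrix Const A + map_matrix Const B :: ('d, 'a) mpoly ^ 2 ^ 2)"
  by (simp add: vec_eq_iff single_add)

section \<open>Powers in the ring of polynomial matrices\<close>

primrec mpow :: "'a::semiring_1 ^ 'n ^ 'n \<Rightarrow> nat \<Rightarrow> 'a ^ 'n ^ 'n" where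
  "mpow F 0 = mat 1"
| "mpow F (Suc n) = mpow F n ** F"

lemma mpow_add: "mpow F (m + n) = mpow F m ** mpow F n"
  by (induction n) (simp_all add: matrix_mul_assoc)

lemma nat_pow_cpoly_mat_ring: "F [^]\<^bsub>cpoly_mat_ring\<^esub> n = mpow F n"
  by (induction n) (simp_all add: cpoly_mat_ring_def)

lemma finsum_cpoly_mat_ring:
  "(\<Oplus>\<^bsub>cpoly_mat_ring\<^esub>k\<in>{..N}. h k) = (\<Sum>k\<le>(N::nat). h k)" for h :: "nat \<Rightarrow> 'd cpoly_mat"
proof -
  interpret ring "cpoly_mat_ring :: 'd cpoly_mat ring" by (rule ring_cpoly_mat_ring)
  have c: "carrier (cpoly_mat_ring :: 'd cpoly_mat ring) = UNIV"
    and a: "x \<oplus>\<^bsub>cpoly_mat_ring\<^esub> y = x + y"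
    and z: "\<zero>\<^bsub>cpoly_mat_ring\<^esub> = (0 :: 'd cpoly_mat)" for x y :: "'d cpoly_mat"
    by (auto simp: cpoly_mat_ring_def)
  show ?thesis
    by (induction N) (simp_all add: c a z add.commute)
qed

lemma power_span_cpoly_mat_ring:
  fixes F :: "'d cpoly_mat"
  shows "power_span cpoly_mat_ring L F N = {\<Sum>k\<le>N. g k ** mpow F k | g. \<forall>k\<le>N. g k \<in> L}"
proof -
  have "x \<otimes>\<^bsub>cpoly_mat_ring\<^esub> y = x ** y" for x y :: "'d cpoly_mat"
    by (simp add: cpoly_mat_ring_def)
  then show ?thesis
    unfolding power_span_def finsum_cpoly_mat_ring nat_pow_cpoly_mat_ring by simp
qed

section \<open>Linear dependence and linear factors\<close>

text \<open>
  Elimination of one coordinate at a time, pivoting on a member of the family that does not vanish there.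
\<close>

lemma infinite_family_dependent:
  fixes v :: "'l \<Rightarrow> 'x \<Rightarrow> 'a::field"
  assumes "finite X" "infinite \<Lambda>"
  shows "\<exists>T \<alpha>. finite T \<and> T \<subseteq> \<Lambda> \<and> (\<exists>l\<in>T. \<alpha> l \<noteq> 0) \<and> (\<forall>x\<in>X. (\<Sum>l\<in>T. \<alpha> l * v l x) = 0)"
  using assms
proof (induction X arbitrary: v \<Lambda> rule: finite_induct)
  case empty
  then obtain l where "l \<in> \<Lambda>" using infinite_imp_nonempty by blast
  then show ?case by (intro exI[of _ "{l}"] exI[of _ "\<lambda>_. 1"]) auto
next
  case (insert x X)
  show ?case
  proof (cases "\<exists>l\<^sub>0\<in>\<Lambda>. v l\<^sub>0 x \<noteq> 0")
    case False
    obtain T \<alpha> where T: "finite T" "T \<subseteq> \<Lambda>" "\<exists>l\<in>T. \<alpha> l \<noteq> 0" "\<forall>y\<in>X. (\<Sum>l\<in>T. \<alpha> l * v l y) = 0"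
      using insert.IH[OF insert.prems, of v] by auto
    have "(\<Sum>l\<in>T. \<alpha> l * v l x) = 0"
      using False T(2) by (intro sum.neutral) auto
    then show ?thesis
      using T by (intro exI[of _ T] exI[of _ \<alpha>]) auto
  next
    case True
    then obtain l\<^sub>0 where l0: "l\<^sub>0 \<in> \<Lambda>" "v l\<^sub>0 x \<noteq> 0" by blast
    define v' where "v' l y = v l y - v l x / v l\<^sub>0 x * v l\<^sub>0 y" for l y
    have "infinite (\<Lambda> - {l\<^sub>0})" using insert.prems by simp
    then obtain T \<alpha> where T: "finite T" "T \<subseteq> \<Lambda> - {l\<^sub>0}" "\<exists>l\<in>T. \<alpha> l \<noteq> 0"
      "\<forall>y\<in>X. (\<Sum>l\<in>T. \<alpha> l * v' l y) = 0"
      using insert.IH[of "\<Lambda> - {l\<^sub>0}" v'] by auto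
    have "(\<Sum>l\<in>T. \<alpha> l * v' l x) = 0"
      using l0 by (simp add: v'_def)
    with T(4) have all0: "(\<Sum>l\<in>T. \<alpha> l * v' l y) = 0" if "y \<in> insert x X" for y
      using that by blast
    define s where "s = (\<Sum>l\<in>T. \<alpha> l * v l x / v l\<^sub>0 x)"
    define \<beta> where "\<beta> = \<alpha>(l\<^sub>0 := - s)"
    have "l\<^sub>0 \<notin> T" using T by blast
    have "(\<Sum>l\<in>insert l\<^sub>0 T. \<beta> l * v l y) = 0" if "y \<in> insert x X" for y
    proof -
      have "(\<Sum>l\<in>insert l\<^sub>0 T. \<beta> l * v l y) = - s * v l\<^sub>0 y + (\<Sum>l\<in>T. \<beta> l * v l y)"
        using T(1) \<open>l\<^sub>0 \<notin> T\<close> by (simp add: \<beta>_def)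
      also have "(\<Sum>l\<in>T. \<beta> l * v l y) = (\<Sum>l\<in>T. \<alpha> l * v l y)"
        using \<open>l\<^sub>0 \<notin> T\<close> by (intro sum.cong) (auto simp: \<beta>_def)
      also have "- s * v l\<^sub>0 y + (\<Sum>l\<in>T. \<alpha> l * v l y) = (\<Sum>l\<in>T. \<alpha> l * v' l y)"
        by (simp add: v'_def s_def right_diff_distrib sum_subtractf sum_distrib_right mult.assoc)
      also have "\<dots> = 0" by (rule all0[OF that])
      finally show ?thesis .
    qed
    moreover have "\<exists>l\<in>insert l\<^sub>0 T. \<beta> l \<noteq> 0"
      using T(3) \<open>l\<^sub>0 \<notin> T\<close> by (auto simp: \<beta>_def)
    ultimately show ?thesis
      using T l0 by (intro exI[of _ "insert l\<^sub>0 T"] exI[of _ \<beta>]) auto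
  qed
qed

lemma infinite_fiber:
  fixes \<kappa> :: "complex \<Rightarrow> 'b::countable"
  shows "\<exists>c. infinite {z. \<kappa> z = c}"
proof (rule ccontr)
  assume "\<nexists>c. infinite {z. \<kappa> z = c}"
  then have "countable (\<Union>c. {z. \<kappa> z = c})"
    by (intro countable_UN) (auto intro: countable_finite)
  moreover have "(\<Union>c. {z. \<kappa> z = c}) = UNIV" by auto
  ultimately show False
    using uncountable_UNIV_complex by simp
qed

text \<open>
  The polynomials with exponents in a box form a finite-dimensional space, and countably many boxes
  exhaust all polynomials.  An uncountable family of polynomials therefore has infinitely many members
  in one box.
\<close>

definition exponent_box :: "nat \<Rightarrow> ('d \<Rightarrow>\<^sub>0 nat) set" where
  "exponent_box D = {m. \<forall>i. Poly_Mapping.lookup m i \<le> D}"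

lemma finite_exponent_box: "finite (exponent_box D :: ('d::finite \<Rightarrow>\<^sub>0 nat) set)"
proof (rule finite_imageD)
  have "Poly_Mapping.lookup ` exponent_box D \<subseteq> PiE (UNIV :: 'd set) (\<lambda>_. {..D})"
    by (auto simp: exponent_box_def)
  then show "finite (Poly_Mapping.lookup ` (exponent_box D :: ('d \<Rightarrow>\<^sub>0 nat) set))"
    by (rule finite_subset) (auto intro: finite_PiE)
qed (auto intro: inj_onI poly_mapping_eqI)

lemma exponent_box_covers:
  fixes K :: "('d::finite \<Rightarrow>\<^sub>0 nat) set"
  assumes "finite K"
  shows "\<exists>D. K \<subseteq> exponent_box D"
proof
  show "K \<subseteq> exponent_box (\<Sum>m\<in>K. \<Sum>i\<in>UNIV. Poly_Mapping.lookup m i)"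
  proof
    fix m assume m: "m \<in> K"
    have "Poly_Mapping.lookup m i \<le> (\<Sum>m\<in>K. \<Sum>i\<in>UNIV. Poly_Mapping.lookup m i)" for i
    proof -
      have "Poly_Mapping.lookup m i \<le> (\<Sum>i\<in>UNIV. Poly_Mapping.lookup m i)"
        by (rule member_le_sum) auto
      also have "\<dots> \<le> (\<Sum>m\<in>K. \<Sum>i\<in>UNIV. Poly_Mapping.lookup m i)"
        using m assms by (intro member_le_sum[of m]) auto
      finally show ?thesis .
    qed
    then show "m \<in> exponent_box (\<Sum>m\<in>K. \<Sum>i\<in>UNIV. Poly_Mapping.lookup m i)"
      by (simp add: exponent_box_def)
  qed
qed

definition eval_at :: "('d, complex) mpoly \<Rightarrow> complex poly \<Rightarrow> ('d, complex) mpoly" where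
  "eval_at x q = poly (map_poly Const q) x"

lemma eval_at_0 [simp]: "eval_at x 0 = 0"
  by (simp add: eval_at_def)

lemma eval_at_pCons [simp]: "eval_at x (pCons a q) = Const a + x * eval_at x q"
  by (simp add: eval_at_def map_poly_pCons)

lemma eval_at_add [simp]: "eval_at x (p + q) = eval_at x p + eval_at x q"
proof (induction p arbitrary: q)
  case (pCons a p)
  then show ?case by (cases q) (simp add: single_add algebra_simps)
qed simp

lemma eval_at_smult [simp]: "eval_at x (smult a q) = Const a * eval_at x q"
  by (induction q) (simp_all add: mult_single algebra_simps)

lemma eval_at_mult [simp]: "eval_at x (p * q) = eval_at x p * eval_at x q"
  by (induction p) (simp_all add: algebra_simps)

lemma eval_at_1 [simp]: "eval_at x 1 = 1"
  by (simp add: one_pCons)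

lemma eval_at_sum: "eval_at x (sum p A) = (\<Sum>k\<in>A. eval_at x (p k))"
  by (induction A rule: infinite_finite_induct) auto

lemma eval_at_prod: "eval_at x (prod p A) = (\<Prod>k\<in>A. eval_at x (p k))"
  by (induction A rule: infinite_finite_induct) auto

lemma eval_at_linear: "eval_at x [:- a, 1:] = x - Const a"
  by (simp add: single_uminus)

lemma prime_ideal_contains_linear_factor:
  fixes K :: "('d, complex) mpoly set"
  assumes K: "lideal K" and one: "1 \<notin> K" and prime: "\<And>p q. p * q \<in> K \<Longrightarrow> p \<in> K \<or> q \<in> K"
    and "q \<noteq> 0" "eval_at x q \<in> K"
  shows "\<exists>a. x - Const a \<in> K"
  using assms(4,5)
proof (induction "degree q" arbitrary: q)
  case 0
  then obtain c where c: "q = [:c:]" "c \<noteq> 0" by (metis degree_eq_zeroE pCons_0_0)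
  then have "Const (1 / c) * Const c \<in> K"
    using 0 lidealD(3)[OF K] by simp
  then show ?case using c one by (simp add: mult_single)
next
  case (Suc n)
  then obtain a where "poly q a = 0" using alg_closed_imp_poly_has_root[of q] by auto
  then obtain r where r: "q = [:- a, 1:] * r" by (meson dvdE poly_eq_0_iff_dvd)
  have "r \<noteq> 0" using r Suc.prems by auto
  then have "degree q = Suc (degree r)" unfolding r by (subst degree_mult_eq) auto
  moreover have "x - Const a \<in> K \<or> eval_at x r \<in> K"
    using prime Suc.prems(2) unfolding r eval_at_mult eval_at_linear by blast
  ultimately show ?case using Suc.hyps \<open>r \<noteq> 0\<close> by auto
qed

text \<open>
  The numerator of \<open>\<Sum>l\<in>T. \<alpha> l / (x - l)\<close>.  It does not vanish identically unless all \<open>\<alpha> l\<close> do, which is the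
  linear independence of the simple fractions.
\<close>

definition partial_fraction_numerator :: "'a set \<Rightarrow> ('a::field \<Rightarrow> 'a) \<Rightarrow> 'a poly" where
  "partial_fraction_numerator T \<alpha> = (\<Sum>l\<in>T. smult (\<alpha> l) (\<Prod>l'\<in>T - {l}. [:- l', 1:]))"

lemma partial_fraction_numerator_nonzero:
  assumes "finite T" "l\<^sub>0 \<in> T" "\<alpha> l\<^sub>0 \<noteq> 0"
  shows "partial_fraction_numerator T \<alpha> \<noteq> 0"
proof -
  have "poly (partial_fraction_numerator T \<alpha>) l\<^sub>0 = (\<Sum>l\<in>T. \<alpha> l * (\<Prod>l'\<in>T - {l}. l\<^sub>0 - l'))"
    by (simp add: partial_fraction_numerator_def poly_sum poly_prod)
  also have "\<dots> = (\<Sum>l\<in>{l\<^sub>0}. \<alpha> l * (\<Prod>l'\<in>T - {l}. l\<^sub>0 - l'))"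
    using assms by (intro sum.mono_neutral_right) (auto intro!: prod_zero)
  also have "\<dots> \<noteq> 0" using assms by auto
  finally show ?thesis by auto
qed

section \<open>The Nullstellensatz for left ideals of matrices\<close>

definition Var :: "'d \<Rightarrow> ('d, 'a::zero_neq_one) mpoly" where
  "Var i = Poly_Mapping.single (Poly_Mapping.single i 1) 1"

lemma single_eq_prod_Var:
  fixes m :: "'d::{finite,linorder} \<Rightarrow>\<^sub>0 nat"
  shows "Poly_Mapping.single m (1::'a::comm_ring_1) = (\<Prod>i\<in>UNIV. Var i ^ Poly_Mapping.lookup m i)"
proof -
  have pow: "Var i ^ k = (Poly_Mapping.single (Poly_Mapping.single i k) 1 :: ('d, 'a) mpoly)" for i k
    by (induction k) (simp_all add: Var_def mult_single flip: single_add)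
  have "(\<Prod>i\<in>A. Poly_Mapping.single (h i) (1::'a)) = Poly_Mapping.single (sum h A) 1"
    if "finite A" for A and h :: "'d \<Rightarrow> 'd \<Rightarrow>\<^sub>0 nat"
    using that by induction (simp_all add: mult_single)
  moreover have "(\<Sum>i\<in>UNIV. Poly_Mapping.single i (Poly_Mapping.lookup m i)) = m"
    by (rule poly_mapping_eqI) (simp add: lookup_sum lookup_single when_def)
  ultimately show ?thesis by (simp add: pow)
qed

text \<open>
  Modulo the ideal every polynomial is congruent to its value at \<open>c\<close>: the polynomials with this
  property form a subring that contains the constants and the variables.
\<close>

lemma ideal_of_point:
  fixes K :: "('d::{finite,linorder}, 'a::comm_ring_1) mpoly set"
  assumes K: "lideal K" and c: "\<And>i. Var i - Const (c $ i) \<in> K"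
  shows "p - Const (poly_value c p) \<in> K"
proof -
  define E where "E = {p. p - Const (poly_value c p) \<in> K}"
  have add: "p + q \<in> E" if "p \<in> E" "q \<in> E" for p q
    using lidealD(2)[OF K, of "p - Const (poly_value c p)" "q - Const (poly_value c q)"] that
    by (simp add: E_def poly_value_add single_add algebra_simps)
  have mult: "p * q \<in> E" if "p \<in> E" "q \<in> E" for p q
  proof -
    have "p * q - Const (poly_value c (p * q)) =
        p * (q - Const (poly_value c q)) + Const (poly_value c q) * (p - Const (poly_value c p))"
      unfolding poly_value_mult by (simp add: algebra_simps mult_single)
    then show ?thesis using that lidealD(2,3)[OF K] by (simp add: E_def)
  qed
  have const: "Const a \<in> E" for a
    using lidealD(1)[OF K] by (simp add: E_def)
  have one: "1 \<in> E" using const[of 1] by simp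
  have var: "Var i \<in> E" for i
  proof -
    have "monom_value c (Poly_Mapping.single i 1) = c $ i"
      by (simp add: monom_value_prod lookup_single when_def if_distrib prod.delta cong: if_cong)
    then show ?thesis using c by (simp add: E_def Var_def poly_value_single)
  qed
  have pow: "q ^ k \<in> E" if "q \<in> E" for q k
    by (induction k) (auto intro: one mult that)
  have "(\<Prod>i\<in>A. Var i ^ Poly_Mapping.lookup m i) \<in> E" for A m
    by (induction A rule: infinite_finite_induct) (auto intro: one mult pow var)
  then have "Poly_Mapping.single m 1 \<in> E" for m
    by (simp add: single_eq_prod_Var)
  then have "Poly_Mapping.single m a \<in> E" for m a
    using mult[OF const] by (metis add_0 mult.right_neutral mult_single)
  then have "p \<in> E"
    by (induction p rule: mpoly_induct) (auto intro: add)
  then show ?thesis by (simp add: E_def)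
qed

definition right_stable :: "'a::ring_1 ^ 'n ^ 'n \<Rightarrow> ('a ^ 'n ^ 'n) set \<Rightarrow> bool" where
  "right_stable F P \<longleftrightarrow> mat_lideal P \<and> (\<forall>G\<in>P. G ** F \<in> P)"

text \<open>
  The noncommutative counterpart of an ideal maximal among those that avoid the powers of a given
  element.  Stability under right multiplication by \<open>F\<close> makes \<open>F\<close> act on the quotient, and maximality
  makes this action injective and lets the central elements outside \<open>P\<close> act injectively too.
\<close>

definition maximal_avoiding :: "'a::ring_1 ^ 'n ^ 'n \<Rightarrow> ('a ^ 'n ^ 'n) set \<Rightarrow> bool" where
  "maximal_avoiding F P \<longleftrightarrow> right_stable F P \<and> (\<forall>N. mpow F N \<notin> P) \<and>
     (\<forall>Q. right_stable F Q \<longrightarrow> (\<forall>N. mpow F N \<notin> Q) \<longrightarrow> P \<subseteq> Q \<longrightarrow> Q = P)"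

lemma right_stable_mpow: "right_stable F P \<Longrightarrow> G \<in> P \<Longrightarrow> G ** mpow F n \<in> P"
  by (induction n) (auto simp: right_stable_def matrix_mul_assoc)

lemma maximal_avoiding_exists:
  assumes "right_stable F L" "\<And>N. mpow F N \<notin> L"
  obtains P where "L \<subseteq> P" "maximal_avoiding F P"
proof -
  define \<A> where "\<A> = {P. right_stable F P \<and> L \<subseteq> P \<and> (\<forall>N. mpow F N \<notin> P)}"
  have "\<exists>M\<in>\<A>. \<forall>X\<in>\<A>. M \<subseteq> X \<longrightarrow> X = M"
  proof (rule subset_Zorn_nonempty)
    have "L \<in> \<A>" using assms by (simp add: \<A>_def)
    then show "\<A> \<noteq> {}" by blast
  next
    fix \<C> assume ne: "\<C> \<noteq> {}" and chain: "subset.chain \<A> \<C>"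
    then have sub: "\<C> \<subseteq> \<A>" and tot: "\<And>X Y. X \<in> \<C> \<Longrightarrow> Y \<in> \<C> \<Longrightarrow> X \<subseteq> Y \<or> Y \<subseteq> X"
      by (auto simp: subset_chain_def)
    have ideal: "mat_lideal X" and stable: "\<And>G. G \<in> X \<Longrightarrow> G ** F \<in> X" if "X \<in> \<C>" for X
      using that sub by (auto simp: \<A>_def right_stable_def)
    have "mat_lideal (\<Union>\<C>)"
      unfolding mat_lideal_def
    proof (intro conjI ballI allI)
      obtain X where "X \<in> \<C>" using ne by blast
      then show "0 \<in> \<Union>\<C>" using mat_lidealD(1)[OF ideal] by (intro UnionI)
      show "M ** x \<in> \<Union>\<C>" if x: "x \<in> \<Union>\<C>" for M x
      proof -
        obtain Y where "Y \<in> \<C>" "x \<in> Y" using x by blast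
        then show ?thesis by (intro UnionI[of Y] mat_lidealD(3)[OF ideal])
      qed
      show "x + y \<in> \<Union>\<C>" if xy: "x \<in> \<Union>\<C>" "y \<in> \<Union>\<C>" for x y
      proof -
        obtain X Y where X: "x \<in> X" "X \<in> \<C>" and Y: "y \<in> Y" "Y \<in> \<C>" using xy by blast
        obtain Z where "x \<in> Z" "y \<in> Z" "Z \<in> \<C>" using tot[OF X(2) Y(2)] X Y by blast
        then show ?thesis by (intro UnionI[of Z] mat_lidealD(2)[OF ideal])
      qed
    qed
    moreover have "\<forall>G\<in>\<Union>\<C>. G ** F \<in> \<Union>\<C>"
      using stable by blast
    moreover have "L \<subseteq> \<Union>\<C>" "\<forall>N. mpow F N \<notin> \<Union>\<C>"
      using ne sub unfolding \<A>_def by blast+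
    ultimately show "\<Union>\<C> \<in> \<A>"
      unfolding \<A>_def right_stable_def by blast
  qed
  then obtain P where P: "P \<in> \<A>" and max: "\<forall>X\<in>\<A>. P \<subseteq> X \<longrightarrow> X = P" ..
  have "Q = P" if "right_stable F Q" "\<forall>N. mpow F N \<notin> Q" "P \<subseteq> Q" for Q
    using max that P unfolding \<A>_def by blast
  then have "maximal_avoiding F P"
    using P unfolding maximal_avoiding_def \<A>_def by blast
  moreover have "L \<subseteq> P" using P by (simp add: \<A>_def)
  ultimately show ?thesis by (intro that)
qed

text \<open>
  The elements carried into \<open>P\<close> by a power of \<open>F\<close> form a stable left ideal that still avoids the powers
  of \<open>F\<close>.
\<close>

lemma maximal_avoiding_cancel:
  assumes P: "maximal_avoiding F P" and G: "G ** mpow F k \<in> P"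
  shows "G \<in> P"
proof -
  define Q where "Q = {G. G ** mpow F k \<in> P}"
  have st: "right_stable F P" and pow: "\<And>N. mpow F N \<notin> P"
    using P by (auto simp: maximal_avoiding_def)
  then have ideal: "mat_lideal P" by (simp add: right_stable_def)
  have comm: "F ** mpow F k = mpow F k ** F"
    using mpow_add[of F 1 k] by simp
  have "G ** F \<in> Q" if "G \<in> Q" for G
  proof -
    have "(G ** mpow F k) ** F \<in> P" using that st by (simp add: Q_def right_stable_def)
    then show ?thesis by (simp add: Q_def comm flip: matrix_mul_assoc)
  qed
  then have "right_stable F Q"
    unfolding right_stable_def mat_lideal_def Q_def using mat_lidealD(1-3)[OF ideal]
    by (simp add: matrix_add_rdistrib flip: matrix_mul_assoc)
  moreover have "P \<subseteq> Q"
    using right_stable_mpow[OF st] by (auto simp: Q_def)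
  moreover have "mpow F N \<notin> Q" for N
    using pow[of "N + k"] by (simp add: Q_def mpow_add)
  ultimately have "Q = P" using P by (simp add: maximal_avoiding_def)
  then show ?thesis using G by (auto simp: Q_def)
qed

lemma maximal_avoiding_prime:
  fixes F :: "'a::comm_ring_1 ^ 'n ^ 'n"
  assumes P: "maximal_avoiding F P" and pq: "mat (p * q) \<in> P"
  shows "mat p \<in> P \<or> mat q \<in> P"
proof -
  define Q where "Q = {G. mat p ** G \<in> P}"
  have st: "right_stable F P" using P by (simp add: maximal_avoiding_def)
  then have ideal: "mat_lideal P" by (simp add: right_stable_def)
  have "mat p ** (G ** F) \<in> P" if "mat p ** G \<in> P" for G
    using that st by (simp add: right_stable_def matrix_mul_assoc)
  then have "right_stable F Q"
    using mat_lidealD(1-3)[OF ideal]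
    by (simp add: Q_def mat_lideal_def matrix_add_ldistrib right_stable_def mat_left_commute)
  moreover have "P \<subseteq> Q"
    using mat_lidealD(3)[OF ideal] by (auto simp: Q_def)
  ultimately have "Q = P \<or> (\<exists>N. mpow F N \<in> Q)"
    using P by (meson maximal_avoiding_def)
  then show ?thesis
  proof
    assume "Q = P"
    then have "mat q \<in> P \<longleftrightarrow> mat p ** mat q \<in> P" by (auto simp: Q_def)
    then show ?thesis using pq by (simp add: mat_mult)
  next
    assume "\<exists>N. mpow F N \<in> Q"
    then obtain N where "mat p ** mpow F N \<in> P" by (auto simp: Q_def)
    then show ?thesis using maximal_avoiding_cancel[OF P] by blast
  qed
qed

text \<open>
  Up to a power of \<open>F\<close>, central elements outside \<open>P\<close> are invertible modulo \<open>P\<close>, as \<open>P\<close> and \<open>s\<close> generate a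
  strictly larger stable left ideal.
\<close>

lemma maximal_avoiding_inverse:
  fixes F :: "'a::comm_ring_1 ^ 'n ^ 'n"
  assumes P: "maximal_avoiding F P" and s: "mat s \<notin> P"
  shows "\<exists>k H. mpow F k - mat s ** H \<in> P"
proof -
  define Q where "Q = {G. \<exists>H. G - mat s ** H \<in> P}"
  have st: "right_stable F P" using P by (simp add: maximal_avoiding_def)
  then have ideal: "mat_lideal P" by (simp add: right_stable_def)
  have add: "G + G' \<in> Q" if GG: "G \<in> Q" "G' \<in> Q" for G G'
  proof -
    obtain H H' where "G - mat s ** H \<in> P" "G' - mat s ** H' \<in> P"
      using GG unfolding Q_def by blast
    then have "(G - mat s ** H) + (G' - mat s ** H') \<in> P"
      by (rule mat_lidealD(2)[OF ideal])
    also have "(G - mat s ** H) + (G' - mat s ** H') = (G + G') - mat s ** (H + H')"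
      by (simp add: matrix_add_ldistrib)
    finally show ?thesis unfolding Q_def by blast
  qed
  have left: "M ** G \<in> Q" if GQ: "G \<in> Q" for M G
  proof -
    obtain H where "G - mat s ** H \<in> P" using GQ unfolding Q_def by blast
    then have "M ** (G - mat s ** H) \<in> P" by (rule mat_lidealD(3)[OF ideal])
    also have "M ** (G - mat s ** H) = M ** G - mat s ** (M ** H)"
      by (simp only: matrix_diff_ldistrib mat_left_commute)
    finally show ?thesis unfolding Q_def by blast
  qed
  have right: "G ** F \<in> Q" if GQ: "G \<in> Q" for G
  proof -
    obtain H where "G - mat s ** H \<in> P" using GQ unfolding Q_def by blast
    then have "(G - mat s ** H) ** F \<in> P" using st by (simp add: right_stable_def)
    also have "(G - mat s ** H) ** F = G ** F - mat s ** (H ** F)"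
      by (simp add: matrix_diff_rdistrib matrix_mul_assoc)
    finally show ?thesis unfolding Q_def by blast
  qed
  have PQ: "P \<subseteq> Q"
  proof
    fix G assume "G \<in> P"
    then have "G - mat s ** 0 \<in> P" by simp
    then show "G \<in> Q" unfolding Q_def by blast
  qed
  have "mat s - mat s ** mat 1 \<in> P"
    using mat_lidealD(1)[OF ideal] by simp
  then have "mat s \<in> Q"
    unfolding Q_def by blast
  moreover have "right_stable F Q"
    unfolding right_stable_def mat_lideal_def
    using add left right PQ mat_lidealD(1)[OF ideal] by blast
  ultimately have "\<exists>N. mpow F N \<in> Q"
    using P PQ s unfolding maximal_avoiding_def by blast
  then show ?thesis by (auto simp: Q_def)
qed

text \<open>
  If no \<open>x - a\<close> were in \<open>P\<close>, then all the fractions \<open>F\<^sup>k / (x - a)\<close> would exist modulo \<open>P\<close>, represented by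
  matrices \<open>H a\<close>.  There are uncountably many of them, so infinitely many have the same \<open>k\<close> and
  entries in the same finite-dimensional space, and some are linearly dependent.  Clearing
  denominators turns the dependence into a nonzero polynomial in \<open>x\<close> that belongs to \<open>P\<close>; as \<open>P\<close> is prime
  for central elements and the complex numbers are algebraically closed, \<open>P\<close> contains a linear factor.
\<close>

lemma maximal_avoiding_residue:
  fixes F :: "'d::finite cpoly_mat"
  assumes P: "maximal_avoiding F P"
  shows "\<exists>a. mat (x - Const a) \<in> P"
proof (rule ccontr)
  assume "\<nexists>a. mat (x - Const a) \<in> P"
  then have "\<exists>k H. mpow F k - mat (x - Const a) ** H \<in> P" for a
    using maximal_avoiding_inverse[OF P] by blast
  then obtain k H where kH: "\<And>a. mpow F (k a) - mat (x - Const a) ** H a \<in> P" by metis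
  have ideal: "mat_lideal P" using P by (simp add: maximal_avoiding_def right_stable_def)
  have "\<exists>D. (\<Union>i. \<Union>j. Poly_Mapping.keys (H a $ i $ j)) \<subseteq> exponent_box D" for a
    by (rule exponent_box_covers) auto
  then obtain D where D: "\<And>a i j. Poly_Mapping.keys (H a $ i $ j) \<subseteq> exponent_box (D a)"
    by (metis (no_types, lifting) SUP_le_iff UNIV_I)
  obtain k\<^sub>0 D\<^sub>0 where inf: "infinite {a. (k a, D a) = (k\<^sub>0, D\<^sub>0)}"
    using infinite_fiber[of "\<lambda>a. (k a, D a)"] by force
  define v :: "complex \<Rightarrow> (2 \<times> 2) \<times> ('d \<Rightarrow>\<^sub>0 nat) \<Rightarrow> complex"
    where "v = (\<lambda>a ((i, j), m). Poly_Mapping.lookup (H a $ i $ j) m)"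
  have fin: "finite ((UNIV :: (2 \<times> 2) set) \<times> (exponent_box D\<^sub>0 :: ('d \<Rightarrow>\<^sub>0 nat) set))"
    using finite_exponent_box by (intro finite_cartesian_product) auto
  obtain T \<alpha> where T: "finite T" "T \<subseteq> {a. (k a, D a) = (k\<^sub>0, D\<^sub>0)}" "\<exists>a\<in>T. \<alpha> a \<noteq> 0"
    and dep: "\<forall>y \<in> UNIV \<times> exponent_box D\<^sub>0. (\<Sum>a\<in>T. \<alpha> a * v a y) = 0"
    using infinite_family_dependent[OF fin inf, of v] by (elim exE conjE) (rule that)
  have TkD: "k a = k\<^sub>0" "D a = D\<^sub>0" if "a \<in> T" for a
    using T(2) that by auto
  have zero: "(\<Sum>a\<in>T. mat (Const (\<alpha> a)) ** H a) = 0"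
  proof -
    have "Poly_Mapping.lookup (\<Sum>a\<in>T. Const (\<alpha> a) * H a $ i $ j) m = 0" for i j m
    proof (cases "m \<in> exponent_box D\<^sub>0")
      case True
      then show ?thesis
        using dep[rule_format, of "((i, j), m)"] by (simp add: lookup_sum lookup_Const_mult v_def)
    next
      case False
      then have "Poly_Mapping.lookup (H a $ i $ j) m = 0" if "a \<in> T" for a
        using D[of a i j] TkD[OF that] by (auto simp: in_keys_iff)
      then show ?thesis by (simp add: lookup_sum lookup_Const_mult)
    qed
    then show ?thesis
      by (simp add: vec_eq_iff nth_mat_mult poly_mapping_eq_iff fun_eq_iff)
  qed
  define q where "q = partial_fraction_numerator T \<alpha>"
  define p where "p a = Const (\<alpha> a) * (\<Prod>b\<in>T - {a}. x - Const b)" for a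
  have q: "eval_at x q = (\<Sum>a\<in>T. p a)"
    by (simp add: q_def p_def partial_fraction_numerator_def eval_at_sum eval_at_prod eval_at_linear
        del: eval_at_pCons)
  have cleared: "mat (p a) ** (mat (x - Const a) ** H a) =
      mat (\<Prod>b\<in>T. x - Const b) ** (mat (Const (\<alpha> a)) ** H a)" if "a \<in> T" for a
    unfolding matrix_mul_assoc mat_mult p_def
    using prod.remove[OF T(1) that, of "\<lambda>b. x - Const b"] by (simp add: mult_ac)
  have "mat (p a) ** mpow F k\<^sub>0 - mat (p a) ** (mat (x - Const a) ** H a) \<in> P" if "a \<in> T" for a
    using mat_lidealD(3)[OF ideal kH[of a], of "mat (p a)"] TkD[OF that]
    by (simp add: matrix_diff_ldistrib)
  then have "(\<Sum>a\<in>T. mat (p a) ** mpow F k\<^sub>0 - mat (p a) ** (mat (x - Const a) ** H a)) \<in> P"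
    by (intro mat_lideal_sum[OF ideal])
  also have "(\<Sum>a\<in>T. mat (p a) ** mpow F k\<^sub>0 - mat (p a) ** (mat (x - Const a) ** H a)) =
      mat (eval_at x q) ** mpow F k\<^sub>0 - mat (\<Prod>b\<in>T. x - Const b) ** (\<Sum>a\<in>T. mat (Const (\<alpha> a)) ** H a)"
    by (simp add: sum_subtractf cleared matrix_sum_ldistrib q mat_sum[symmetric] matrix_sum_rdistrib)
  also have "\<dots> = mat (eval_at x q) ** mpow F k\<^sub>0"
    by (simp add: zero)
  finally have "mat (eval_at x q) \<in> P"
    by (rule maximal_avoiding_cancel[OF P])
  define K where "K = {p. mat p \<in> P}"
  have "lideal K"
    using mat_lidealD[OF ideal] by (auto simp: lideal_def K_def mat_add[symmetric] mat_mult[symmetric])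
  moreover have "1 \<notin> K"
    using P unfolding maximal_avoiding_def K_def by (metis mem_Collect_eq mpow.simps(1))
  moreover have "q \<noteq> 0"
    using T partial_fraction_numerator_nonzero unfolding q_def by blast
  ultimately have "\<exists>a. x - Const a \<in> K"
    using maximal_avoiding_prime[OF P] \<open>mat (eval_at x q) \<in> P\<close>
    by (intro prime_ideal_contains_linear_factor[of K q]) (auto simp: K_def)
  then show False
    using \<open>\<nexists>a. mat (x - Const a) \<in> P\<close> by (simp add: K_def)
qed

lemma power_span_add_index:
  assumes "0 \<in> L" "G \<in> power_span cpoly_mat_ring L F M" "M \<le> N"
  shows "G \<in> power_span cpoly_mat_ring L F N"
proof -
  obtain g where g: "\<forall>k\<le>M. g k \<in> L" and G: "G = (\<Sum>k\<le>M. g k ** mpow F k)"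
    using assms(2) by (auto simp: power_span_cpoly_mat_ring)
  define h where "h k = (if k \<le> M then g k else 0)" for k
  have "(\<Sum>k\<le>N. h k ** mpow F k) = (\<Sum>k\<le>M. h k ** mpow F k)"
    using assms(3) by (intro sum.mono_neutral_right) (auto simp: h_def)
  also have "\<dots> = G" unfolding G by (intro sum.cong) (auto simp: h_def)
  finally show ?thesis
    unfolding power_span_cpoly_mat_ring using g assms(1)
    by (intro CollectI exI[of _ h]) (auto simp: h_def)
qed

lemma right_stable_power_spans:
  assumes L: "mat_lideal L"
  shows "right_stable F (\<Union>N. power_span cpoly_mat_ring L F N)" (is "right_stable F ?S")
proof -
  note ps = power_span_cpoly_mat_ring
  have add: "x + y \<in> ?S" if xy: "x \<in> ?S" "y \<in> ?S" for x y
  proof -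
    obtain M N where "x \<in> power_span cpoly_mat_ring L F M" "y \<in> power_span cpoly_mat_ring L F N"
      using xy by auto
    then have "x \<in> power_span cpoly_mat_ring L F (max M N)"
      "y \<in> power_span cpoly_mat_ring L F (max M N)"
      using power_span_add_index[OF mat_lidealD(1)[OF L]] by (meson max.cobounded1 max.cobounded2)+
    then obtain g h where "\<forall>k\<le>max M N. g k \<in> L" "\<forall>k\<le>max M N. h k \<in> L"
      "x + y = (\<Sum>k\<le>max M N. (g k + h k) ** mpow F k)"
      unfolding ps by (auto simp: matrix_add_rdistrib sum.distrib)
    then have "x + y \<in> power_span cpoly_mat_ring L F (max M N)"
      unfolding ps using mat_lidealD(2)[OF L] by (intro CollectI exI[of _ "\<lambda>k. g k + h k"]) auto
    then show ?thesis by blast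
  qed
  have left: "A ** x \<in> ?S" if "x \<in> ?S" for A x
  proof -
    obtain N g where g: "\<forall>k\<le>N. g k \<in> L" "x = (\<Sum>k\<le>N. g k ** mpow F k)"
      using \<open>x \<in> ?S\<close> unfolding ps by blast
    then have "A ** x \<in> power_span cpoly_mat_ring L F N"
      unfolding ps using mat_lidealD(3)[OF L]
      by (intro CollectI exI[of _ "\<lambda>k. A ** g k"]) (auto simp: matrix_sum_ldistrib matrix_mul_assoc)
    then show ?thesis by blast
  qed
  have right: "x ** F \<in> ?S" if "x \<in> ?S" for x
  proof -
    obtain N g where g: "\<forall>k\<le>N. g k \<in> L" "x = (\<Sum>k\<le>N. g k ** mpow F k)"
      using \<open>x \<in> ?S\<close> unfolding ps by blast
    define h where "h k = (case k of 0 \<Rightarrow> 0 | Suc k \<Rightarrow> g k)" for k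
    have "x ** F = (\<Sum>k\<le>Suc N. h k ** mpow F k)"
      unfolding g(2) matrix_sum_rdistrib sum.atMost_Suc_shift by (simp add: h_def matrix_mul_assoc)
    moreover have "\<forall>k\<le>Suc N. h k \<in> L"
      using g(1) mat_lidealD(1)[OF L] by (auto simp: h_def split: nat.split)
    ultimately have "x ** F \<in> power_span cpoly_mat_ring L F (Suc N)"
      unfolding ps by blast
    then show ?thesis by blast
  qed
  have "0 \<in> power_span cpoly_mat_ring L F 0"
    unfolding ps using mat_lidealD(1)[OF L] by (intro CollectI exI[of _ "\<lambda>_. 0"]) auto
  then have zero: "0 \<in> ?S" by (rule UN_I[OF UNIV_I])
  show ?thesis
    unfolding right_stable_def mat_lideal_def
    by (intro conjI ballI allI zero add left right)
qed

text \<open>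
  If the conclusion fails, \<open>L + L F + L F\<^sup>2 + \<dots>\<close> avoids all powers of \<open>F\<close> and extends to a maximal such
  \<open>P\<close>.  By \<open>maximal_avoiding_residue\<close> each variable is congruent to a scalar modulo \<open>P\<close>, so \<open>P\<close> is the preimage
  under evaluation at a point \<open>c\<close> of a left ideal of complex matrices without \<open>F(c)\<close>.  A vector separating
  the two contradicts \<open>F\<close> being in the radical.
\<close>

theorem matrix_nullstellensatz:
  fixes F :: "'d::{finite,linorder} cpoly_mat"
  assumes L: "mat_lideal L" and F: "F \<in> cpoly_mat_radical L"
  shows "\<exists>N. mpow F N \<in> power_span cpoly_mat_ring L F N"
proof (rule ccontr)
  assume no: "\<nexists>N. mpow F N \<in> power_span cpoly_mat_ring L F N"
  let ?S = "\<Union>N. power_span cpoly_mat_ring L F N"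
  note ps = power_span_cpoly_mat_ring
  \<comment> \<open>The exponent on the left need not be the number of summands; multiplication by a power of
    \<open>F\<close> from the left makes it at least as large.\<close>
  have "mpow F M \<notin> ?S" for M
  proof
    assume "mpow F M \<in> ?S"
    then obtain N g where g: "\<forall>k\<le>N. g k \<in> L" and eq: "mpow F M = (\<Sum>k\<le>N. g k ** mpow F k)"
      unfolding ps by blast
    have "mpow F (N + M) = (\<Sum>k\<le>N. (mpow F N ** g k) ** mpow F k)"
      unfolding mpow_add eq by (simp add: matrix_sum_ldistrib matrix_mul_assoc)
    then have "mpow F (N + M) \<in> power_span cpoly_mat_ring L F N"
      unfolding ps using g mat_lidealD(3)[OF L]
      by (intro CollectI exI[of _ "\<lambda>k. mpow F N ** g k"]) auto
    then show False
      using no power_span_add_index[OF mat_lidealD(1)[OF L], of _ F N "N + M"] by auto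
  qed
  then obtain P where SP: "?S \<subseteq> P" and P: "maximal_avoiding F P"
    using maximal_avoiding_exists[OF right_stable_power_spans[OF L]] by blast
  have "L \<subseteq> P"
  proof
    fix G assume "G \<in> L"
    then have "G \<in> power_span cpoly_mat_ring L F 0"
      unfolding ps by (intro CollectI exI[of _ "\<lambda>_. G"]) auto
    then have "G \<in> ?S" by (rule UN_I[OF UNIV_I])
    then show "G \<in> P" by (rule subsetD[OF SP])
  qed
  have ideal: "mat_lideal P" using P by (simp add: maximal_avoiding_def right_stable_def)
  have "\<forall>i. \<exists>a. mat (Var i - Const a) \<in> P"
    using maximal_avoiding_residue[OF P] by blast
  then obtain a where a: "\<And>i. mat (Var i - Const (a i)) \<in> P" by metis
  define c :: "complex ^ ('d::{finite,linorder})" where "c = (\<chi> i. a i)"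
  have "lideal {p. mat p \<in> P}"
    using mat_lidealD[OF ideal] by (auto simp: lideal_def mat_add[symmetric] mat_mult[symmetric])
  then have residue: "mat (p - Const (poly_value c p)) \<in> P" for p
    using ideal_of_point[of "{p. mat p \<in> P}" c p] a by (simp add: c_def)
  have "G - map_matrix Const (mat_value c G) \<in> P" for G
    by (rule mat_lideal_entries[OF ideal]) (simp add: mat_value_def residue)
  then have value_iff: "G \<in> P \<longleftrightarrow> map_matrix Const (mat_value c G) \<in> P" for G
    by (rule mat_lideal_cong_diff[OF ideal])
  define P\<^sub>0 where "P\<^sub>0 = {A. map_matrix Const A \<in> P}"
  have "map_matrix Const (0 :: complex ^ 2 ^ 2) = (0 :: 'd cpoly_mat)"
    by (simp add: vec_eq_iff)
  then have "mat_lideal P\<^sub>0"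
    using mat_lidealD(1-3)[OF ideal]
    by (simp add: mat_lideal_def P\<^sub>0_def map_matrix_Const_add map_matrix_Const_mult)
  moreover have "mpow F (Suc 0) \<notin> P"
    using P unfolding maximal_avoiding_def by blast
  then have "mat_value c F \<notin> P\<^sub>0"
    by (simp add: P\<^sub>0_def flip: value_iff)
  ultimately obtain w where w: "\<And>A. A \<in> P\<^sub>0 \<Longrightarrow> A *v w = 0" "mat_value c F *v w \<noteq> 0"
    by (rule mat_lideal_separate) (rule that)
  have "mat_value c G *v w = 0" if "G \<in> L" for G
    using subsetD[OF \<open>L \<subseteq> P\<close> that] by (intro w(1)) (simp add: P\<^sub>0_def flip: value_iff)
  moreover have "w \<noteq> 0" using w(2) by auto
  ultimately show False
    using F w(2) unfolding cpoly_mat_radical_def by blast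
qed

section \<open>Quaternions as complex vectors\<close>

primcorec qcnj :: "quat \<Rightarrow> quat" where
  "Re0 (qcnj x) = Re0 x"
| "Im1 (qcnj x) = - Im1 x"
| "Im2 (qcnj x) = - Im2 x"
| "Im3 (qcnj x) = - Im3 x"

lemma quat_inverse_exists:
  fixes h :: quat
  assumes "h \<noteq> 0"
  shows "\<exists>k. h * k = 1 \<and> k * h = 1"
proof -
  define n where "n = Re0 h * Re0 h + Im1 h * Im1 h + Im2 h * Im2 h + Im3 h * Im3 h"
  have "n \<noteq> 0"
    using assms unfolding n_def quat_eq_iff
    by (metis add_nonneg_eq_0_iff add_nonneg_nonneg mult_eq_0_iff zero_le_square zero_quat.simps)
  define k where "k = qcnj h * Quat (1 / n) 0 0 0"
  have "h * k = 1" "k * h = 1"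
    using \<open>n \<noteq> 0\<close> unfolding k_def quat_eq_iff
    by (simp_all add: field_simps) (simp_all add: n_def algebra_simps)
  then show ?thesis by blast
qed

lemma quat_mult_eq_0: "x * h = 0 \<Longrightarrow> h \<noteq> 0 \<Longrightarrow> x = (0 :: quat)"
  using quat_inverse_exists[of h] by (metis mult.assoc mult_zero_left mult_1_right)

lemma quat_of_complex_mult: "quat_of_complex (z * w) = quat_of_complex z * quat_of_complex w"
  by (simp add: quat_eq_iff quat_of_complex_def)

lemma quat_of_complex_1 [simp]: "quat_of_complex 1 = 1"
  by (simp add: quat_eq_iff quat_of_complex_def)

text \<open>
  Write \<open>a = \<alpha> + v\<close> with \<open>v\<close> purely imaginary of length \<open>r\<close>, so that \<open>v\<^sup>2 = - r\<^sup>2\<close>.  Then \<open>h = v + r \<^bold>i\<close> satisfies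
  \<open>v h = h (r \<^bold>i)\<close>.  It vanishes only for \<open>v = - r \<^bold>i\<close>, where \<open>h = \<^bold>j\<close> does the same.
\<close>

lemma quat_diagonalizable:
  obtains h z where "h \<noteq> 0" "a * h = h * quat_of_complex z" "Im z = 0 \<Longrightarrow> a = quat_of_complex z"
proof -
  define r where "r = sqrt (Im1 a * Im1 a + Im2 a * Im2 a + Im3 a * Im3 a)"
  have rr: "r * r = Im1 a * Im1 a + Im2 a * Im2 a + Im3 a * Im3 a"
    unfolding r_def by (rule real_sqrt_mult_self[THEN trans]) (simp add: add_nonneg_nonneg)
  define z where "z = Complex (Re0 a) r"
  have real: "a = quat_of_complex z" if "Im z = 0"
  proof -
    have "Im1 a = 0 \<and> Im2 a = 0 \<and> Im3 a = 0"
      using rr that by (simp add: z_def) (metis add_nonneg_eq_0_iff add_nonneg_nonneg mult_eq_0_iff zero_le_square)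
    then show ?thesis using that by (simp add: z_def quat_eq_iff quat_of_complex_def)
  qed
  define h\<^sub>1 where "h\<^sub>1 = Quat 0 (Im1 a + r) (Im2 a) (Im3 a)"
  show ?thesis
  proof (cases "h\<^sub>1 = 0")
    case False
    have "a * h\<^sub>1 = h\<^sub>1 * quat_of_complex z"
      using rr by (simp add: quat_eq_iff h\<^sub>1_def quat_of_complex_def z_def algebra_simps)
    then show ?thesis using that False real by blast
  next
    case True
    then have a: "Im1 a = - r" "Im2 a = 0" "Im3 a = 0"
      by (auto simp: h\<^sub>1_def quat_eq_iff)
    have "a * quat_j = quat_j * quat_of_complex z"
      using a by (simp add: quat_eq_iff quat_j_def quat_of_complex_def z_def)
    moreover have "quat_j \<noteq> 0" by (simp add: quat_eq_iff quat_j_def)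
    ultimately show ?thesis using that real by blast
  qed
qed

text \<open>
  A coordinate that is not real is conjugated to a complex number that is not real.  The other
  coordinates, conjugated in the same way, commute with it and hence are complex.
\<close>

lemma commuting_point_diagonalizable:
  assumes "a \<in> commuting_points"
  obtains h c where "h \<noteq> 0" "\<And>i. a $ i * h = h * quat_of_complex (c $ i)"
proof (cases "\<forall>i. \<exists>z. Im z = 0 \<and> a $ i = quat_of_complex z")
  case True
  then obtain c where c: "\<And>i. a $ i = quat_of_complex (c i)" by metis
  show ?thesis
    by (rule that[of 1 "\<chi> i. c i"]) (simp_all add: c quat_eq_iff)
next
  case False
  then obtain l where l: "\<And>z. Im z = 0 \<Longrightarrow> a $ l \<noteq> quat_of_complex z" by blast
  obtain h z where h: "h \<noteq> 0" and z: "a $ l * h = h * quat_of_complex z"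
    "Im z = 0 \<Longrightarrow> a $ l = quat_of_complex z"
    by (rule quat_diagonalizable[of "a $ l"]) (rule that)
  have im: "Im z \<noteq> 0" using l z(2) by blast
  obtain k where k: "h * k = 1" "k * h = 1" using quat_inverse_exists[OF h] by blast
  have "\<exists>y. a $ i * h = h * quat_of_complex y" for i
  proof -
    define b where "b = k * (a $ i * h)"
    have hb: "h * b = a $ i * h" unfolding b_def using k(1) by (simp flip: mult.assoc)
    have "h * (b * quat_of_complex z) = a $ i * a $ l * h"
      using hb z(1) by (metis mult.assoc)
    also have "\<dots> = a $ l * a $ i * h"
      using assms by (simp add: commuting_points_def)
    also have "\<dots> = h * (quat_of_complex z * b)"
      using hb z(1) by (metis mult.assoc)
    finally have comm: "b * quat_of_complex z = quat_of_complex z * b"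
      using k(2) by (metis mult.assoc mult_1_left)
    have "Im3 b * Im z = 0" "Im2 b * Im z = 0"
      using comm by (simp_all add: quat_eq_iff quat_of_complex_def algebra_simps)
    then have "b = quat_of_complex (cpart b)"
      using im by (simp add: quat_eq_iff quat_of_complex_def cpart_def)
    then show ?thesis using hb by metis
  qed
  then obtain c where c: "\<And>i. a $ i * h = h * quat_of_complex (c i)" by metis
  show ?thesis by (rule that[of h "\<chi> i. c i"]) (simp_all add: c h)
qed

text \<open>
  The coordinates of a quaternion over the complex numbers acting from the right.  Left multiplication
  by \<open>b\<close> is linear in them, with matrix \<open>quat_mat b\<close>.
\<close>

definition quat_vec :: "quat \<Rightarrow> complex ^ 2" where
  "quat_vec h = vector [cpart h, jpart h]"

lemma quat_vec_eq_0 [simp]: "quat_vec h = 0 \<longleftrightarrow> h = 0"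
  by (auto simp: vec_eq_iff forall_2 quat_vec_def complex_eq_iff cpart_def jpart_def quat_eq_iff)

lemma quat_vec_add: "quat_vec (g + h) = quat_vec g + quat_vec h"
  by (simp add: vec_eq_iff forall_2 quat_vec_def complex_eq_iff cpart_def jpart_def)

lemma surj_quat_vec: obtains h where "w = quat_vec h"
  by (rule that[of "Quat (Re (w $ 1)) (Im (w $ 1)) (Re (w $ 2)) (- Im (w $ 2))"])
     (simp add: vec_eq_iff forall_2 quat_vec_def complex_eq_iff cpart_def jpart_def)

definition quat_mat :: "quat \<Rightarrow> complex ^ 2 ^ 2" where
  "quat_mat b = vector [vector [cpart b, - cnj (jpart b)], vector [jpart b, cnj (cpart b)]]"

lemma quat_mat_vec: "quat_mat b *v quat_vec h = quat_vec (b * h)"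
  by (simp add: vec_eq_iff forall_2 quat_vec_def quat_mat_def matrix_vector_mult_def sum_2
      complex_eq_iff cpart_def jpart_def algebra_simps)

lemma quat_vec_mult_complex: "quat_vec (h * quat_of_complex z) = z *s quat_vec h"
  by (simp add: vec_eq_iff forall_2 quat_vec_def complex_eq_iff cpart_def jpart_def
      quat_of_complex_def algebra_simps)

lemma phi_Const: "phi (Const b) = map_matrix Const (quat_mat b)"
  by (simp add: phi_single vec_eq_iff forall_2 quat_mat_def single_uminus)

section \<open>Quaternionic polynomials inside the complex matrices\<close>

lemma phi_0 [simp]: "phi 0 = 0"
  using phi_add[of 0 0] by simp

lemma phi_uminus: "phi (- f) = - phi f"
  using phi_add[of f "- f"] by (simp add: add_eq_0_iff2)

lemma phi_diff: "phi (f - g) = phi f - phi g"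
  using phi_add[of f "- g"] by (simp add: phi_uminus)

lemma phi_sum: "phi (sum g A) = (\<Sum>k\<in>A. phi (g k))"
  by (induction A rule: infinite_finite_induct) (auto simp: phi_add)

lemma imaginary_mult: "map_matrix (\<lambda>p. Const \<i> * p) M = mat (Const \<i>) ** M"
  by (simp add: vec_eq_iff nth_mat_mult)

lemma phi_ideal_eq: "phi_ideal I = {phi u + mat (Const \<i>) ** phi v | u v. u \<in> I \<and> v \<in> I}"
  by (simp add: phi_ideal_def imaginary_mult)

text \<open>
  The conjugation that exchanges the diagonal entries, exchanges and negates the others, and
  conjugates all of them, is antilinear with fixed ring the image of \<open>phi\<close>; the
  two components are the halves of the sum and of the difference of \<open>M\<close> and its conjugate.
\<close>

lemma phi_complexification:
  obtains a b where "M = phi a + mat (Const \<i>) ** phi b"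
proof -
  let ?hp = "\<lambda>p q. Poly_Mapping.map quat_of_complex p + Const quat_j * Poly_Mapping.map quat_of_complex q"
  let ?c = "Poly_Mapping.map cnj"
  define a where "a = ?hp (Const (1/2) * (M $ 1 $ 1 + ?c (M $ 2 $ 2))) (Const (1/2) * (M $ 2 $ 1 - ?c (M $ 1 $ 2)))"
  define b where "b = ?hp (Const (- \<i>/2) * (M $ 1 $ 1 - ?c (M $ 2 $ 2))) (Const (- \<i>/2) * (M $ 2 $ 1 + ?c (M $ 1 $ 2)))"
  have "M = phi a + mat (Const \<i>) ** phi b"
    unfolding a_def b_def phi_decomp vec_eq_iff forall_2
    by (intro conjI poly_mapping_eqI; simp add: nth_mat_mult lookup_add lookup_minus
        lookup_Const_mult lookup_map_0 complex_eq_iff; simp add: field_simps)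
  then show ?thesis by (rule that)
qed

lemma phi_complexification_unique:
  assumes "phi u + mat (Const \<i>) ** phi v = 0"
  shows "u = 0"
proof -
  have e: "phi u $ i $ j + Const \<i> * phi v $ i $ j = 0" for i j
    using assms by (simp add: vec_eq_iff nth_mat_mult)
  have "Poly_Mapping.lookup u m = 0" for m
  proof -
    have "Poly_Mapping.lookup (phi u $ i $ j) m + \<i> * Poly_Mapping.lookup (phi v $ i $ j) m = 0" for i j
      using arg_cong[OF e[of i j], of "\<lambda>p. Poly_Mapping.lookup p m"]
      by (simp add: lookup_add lookup_Const_mult)
    from this[of 1 1] this[of 1 2] this[of 2 1] this[of 2 2] show ?thesis
      by (simp add: phi_def Let_def lookup_map_0 complex_eq_iff cpart_def jpart_def quat_eq_iff)
  qed
  then show ?thesis by (intro poly_mapping_eqI) simp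
qed

lemma imaginary_square: "mat (Const \<i>) ** (mat (Const \<i>) ** M) = - M"
  by (simp add: vec_eq_iff nth_mat_mult flip: mult.assoc) (simp add: mult_single single_uminus)

lemma mat_lideal_phi_ideal:
  assumes I: "lideal I"
  shows "mat_lideal (phi_ideal I)"
proof -
  have add: "x + y \<in> phi_ideal I" if xy: "x \<in> phi_ideal I" "y \<in> phi_ideal I" for x y
  proof -
    obtain u v u' v' where uv: "u \<in> I" "v \<in> I" "u' \<in> I" "v' \<in> I"
      and "x = phi u + mat (Const \<i>) ** phi v" "y = phi u' + mat (Const \<i>) ** phi v'"
      using xy unfolding phi_ideal_eq by blast
    then have "x + y = phi (u + u') + mat (Const \<i>) ** phi (v + v')"
      by (simp add: phi_add matrix_add_ldistrib)
    then show ?thesis using uv lidealD(2)[OF I] unfolding phi_ideal_eq by blast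
  qed
  have mult: "M ** x \<in> phi_ideal I" if x: "x \<in> phi_ideal I" for M x
  proof -
    obtain u v where uv: "u \<in> I" "v \<in> I" and xe: "x = phi u + mat (Const \<i>) ** phi v"
      using x unfolding phi_ideal_eq by blast
    obtain a b where M: "M = phi a + mat (Const \<i>) ** phi b" by (rule phi_complexification)
    have "M ** x = phi a ** phi u + phi a ** (mat (Const \<i>) ** phi v)
        + (mat (Const \<i>) ** (phi b ** phi u) + mat (Const \<i>) ** (phi b ** (mat (Const \<i>) ** phi v)))"
      unfolding M xe by (simp add: matrix_add_ldistrib matrix_add_rdistrib flip: matrix_mul_assoc)
    also have "\<dots> = phi (a * u - b * v) + mat (Const \<i>) ** phi (a * v + b * u)"
      unfolding mat_left_commute[of "Const \<i>" "phi a", symmetric]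
        mat_left_commute[of "Const \<i>" "phi b", symmetric] imaginary_square
      by (simp add: phi_add phi_diff phi_mult matrix_add_ldistrib)
    also have "\<dots> \<in> phi_ideal I"
    proof -
      have "a * u - b * v \<in> I" "a * v + b * u \<in> I"
        using uv by (auto intro!: lidealD(2-4)[OF I])
      then show ?thesis unfolding phi_ideal_eq by blast
    qed
    finally show ?thesis .
  qed
  have "phi 0 + mat (Const \<i>) ** phi 0 \<in> phi_ideal I"
    using lidealD(1)[OF I] unfolding phi_ideal_eq by blast
  then show ?thesis unfolding mat_lideal_def using add mult by simp
qed

lemma phi_mem_phi_ideal:
  assumes "lideal I" "u \<in> I"
  shows "phi u \<in> phi_ideal I"
proof -
  have "phi u + mat (Const \<i>) ** phi 0 \<in> phi_ideal I"
    using assms(2) lidealD(1)[OF assms(1)] unfolding phi_ideal_eq by blast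
  then show ?thesis by simp
qed

section \<open>Zeros at commuting quaternions and at complex points\<close>

text \<open>
  If \<open>a = h c h\<^sup>-\<^sup>1\<close>, then \<open>f(a) h = \<Sum> b\<^sub>m h c\<^sup>m\<close>: the complex monomials act on \<open>h\<close> from the right, that is as
  scalars, and the coefficients from the left, that is through \<open>quat_mat\<close>.
\<close>

lemma quat_vec_poly_value:
  fixes a :: "quat ^ 'd::{finite,linorder}"
  assumes "\<And>i. a $ i * h = h * quat_of_complex (c $ i)"
  shows "quat_vec (poly_value a f * h) = mat_value c (phi f) *v quat_vec h"
proof (induction f rule: mpoly_induct)
  case (single m b)
  have pow: "(a $ i) ^ k * h = h * quat_of_complex ((c $ i) ^ k)" for i k
  proof (induction k)
    case (Suc k)
    have "(a $ i) ^ Suc k * h = a $ i * ((a $ i) ^ k * h)" by (simp add: mult.assoc)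
    also have "\<dots> = (a $ i * h) * quat_of_complex ((c $ i) ^ k)"
      unfolding Suc by (simp add: mult.assoc)
    finally show ?case unfolding assms by (simp add: quat_of_complex_mult mult.assoc)
  qed simp
  have "prod_list (map (\<lambda>i. (a $ i) ^ Poly_Mapping.lookup m i) xs) * h =
      h * quat_of_complex (prod_list (map (\<lambda>i. (c $ i) ^ Poly_Mapping.lookup m i) xs))" for xs
  proof (induction xs)
    case (Cons i xs)
    then show ?case
      by (simp add: mult.assoc quat_of_complex_mult) (simp add: pow flip: mult.assoc)
  qed simp
  then have mono: "monom_value a m * h = h * quat_of_complex (monom_value c m)"
    unfolding monom_value_def .
  have "quat_vec (poly_value a (Poly_Mapping.single m b) * h) =
      monom_value c m *s (quat_mat b *v quat_vec h)"
    by (simp add: poly_value_single mono mult.assoc quat_mat_vec flip: quat_vec_mult_complex)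
  also have "\<dots> = mat_value c (phi (Poly_Mapping.single m b)) *v quat_vec h"
    by (simp add: vec_eq_iff forall_2 matrix_vector_mult_def sum_2 quat_mat_def mat_value_def
        phi_single poly_value_single algebra_simps flip: single_uminus)
  finally show ?case .
next
  case (add f g)
  then show ?case
    by (simp add: poly_value_add distrib_right quat_vec_add phi_add mat_value_add
        matrix_vector_mult_add_rdistrib)
qed

lemma mat_value_phi_ideal:
  assumes "lideal I"
  shows "(\<forall>G\<in>phi_ideal I. mat_value c G *v w = 0) \<longleftrightarrow> (\<forall>u\<in>I. mat_value c (phi u) *v w = 0)"
proof
  assume *: "\<forall>u\<in>I. mat_value c (phi u) *v w = 0"
  show "\<forall>G\<in>phi_ideal I. mat_value c G *v w = 0"
  proof
    fix G assume "G \<in> phi_ideal I"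
    then obtain u v where uv: "u \<in> I" "v \<in> I" and G: "G = phi u + mat (Const \<i>) ** phi v"
      unfolding phi_ideal_eq by blast
    show "mat_value c G *v w = 0"
      using * uv unfolding G
      by (simp add: mat_value_add mat_value_mult matrix_vector_mult_add_rdistrib
          flip: matrix_vector_mul_assoc)
  qed
qed (use phi_mem_phi_ideal[OF assms] in blast)

text \<open>
  Zeros \<open>(c, w)\<close> and commuting points \<open>a\<close> correspond by \<open>w = quat_vec h\<close> and \<open>a = h c h\<^sup>-\<^sup>1\<close>.
\<close>

theorem hpoly_radical_iff:
  fixes I :: "'d::{finite,linorder} hpoly set"
  assumes I: "lideal I"
  shows "f \<in> hpoly_radical I \<longleftrightarrow> phi f \<in> cpoly_mat_radical (phi_ideal I)"
proof
  assume f: "f \<in> hpoly_radical I"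
  show "phi f \<in> cpoly_mat_radical (phi_ideal I)"
    unfolding cpoly_mat_radical_def mat_value_phi_ideal[OF I]
  proof (intro CollectI allI impI)
    fix c :: "complex ^ ('d::{finite,linorder})" and w :: "complex ^ 2"
    assume "w \<noteq> 0" and zero: "\<forall>u\<in>I. mat_value c (phi u) *v w = 0"
    obtain h where h: "w = quat_vec h" by (rule surj_quat_vec)
    have "h \<noteq> 0" using \<open>w \<noteq> 0\<close> h by auto
    then obtain k where k: "h * k = 1" "k * h = 1" using quat_inverse_exists by blast
    define a :: "quat ^ ('d::{finite,linorder})" where "a = (\<chi> i. h * quat_of_complex (c $ i) * k)"
    have ah: "a $ i * h = h * quat_of_complex (c $ i)" for i
      using k(2) by (simp add: a_def mult.assoc)
    have "a $ i * a $ j = h * quat_of_complex (c $ i * c $ j) * k" for i j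
    proof -
      have "a $ i * a $ j = (a $ i * h) * quat_of_complex (c $ j) * k"
        by (simp add: a_def[THEN arg_cong, of "\<lambda>a. a $ j"] mult.assoc)
      then show ?thesis unfolding ah by (simp add: quat_of_complex_mult mult.assoc)
    qed
    then have "a \<in> commuting_points"
      by (simp add: commuting_points_def mult.commute)
    moreover have "poly_value a u = 0" if "u \<in> I" for u
      using zero that quat_vec_poly_value[of a h c u, OF ah] quat_mult_eq_0 \<open>h \<noteq> 0\<close>
      unfolding h by (metis quat_vec_eq_0)
    ultimately have "poly_value a f = 0"
      using f unfolding hpoly_radical_def by blast
    then show "mat_value c (phi f) *v w = 0"
      using quat_vec_poly_value[of a h c f, OF ah] unfolding h by (simp add: quat_vec_eq_0[THEN iffD2])
  qed
next
  assume f: "phi f \<in> cpoly_mat_radical (phi_ideal I)"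
  show "f \<in> hpoly_radical I"
    unfolding hpoly_radical_def
  proof (intro CollectI ballI impI)
    fix a assume a: "a \<in> commuting_points" and zero: "\<forall>g\<in>I. poly_value a g = 0"
    obtain h c where h: "h \<noteq> 0" and ah: "\<And>i. a $ i * h = h * quat_of_complex (c $ i)"
      using commuting_point_diagonalizable[OF a] by blast
    note val = quat_vec_poly_value[of a h c, OF ah]
    have "\<forall>u\<in>I. mat_value c (phi u) *v quat_vec h = 0"
      using zero by (simp flip: val)
    then have "mat_value c (phi f) *v quat_vec h = 0"
      using f h unfolding cpoly_mat_radical_def mat_value_phi_ideal[OF I] by simp
    then have "poly_value a f * h = 0" by (simp flip: val)
    then show "poly_value a f = 0" using quat_mult_eq_0 h by blast
  qed
qed

section \<open>Conjugation of quaternionic polynomials\<close>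

lemma qcnj_simps: "qcnj 0 = 0" "qcnj (x + y) = qcnj x + qcnj y" "qcnj (x * y) = qcnj y * qcnj x"
  "qcnj (qcnj x) = x"
  by (simp_all add: quat_eq_iff algebra_simps)

definition hcnj :: "'d hpoly \<Rightarrow> 'd hpoly" where
  "hcnj = Poly_Mapping.map qcnj"

lemma hcnj_add: "hcnj (f + g) = hcnj f + hcnj g"
  by (rule poly_mapping_eqI) (simp add: hcnj_def lookup_map_0 lookup_add qcnj_simps)

lemma hcnj_single: "hcnj (Poly_Mapping.single m b) = Poly_Mapping.single m (qcnj b)"
  by (rule poly_mapping_eqI) (simp add: hcnj_def lookup_map_0 lookup_single when_def qcnj_simps)

lemma hcnj_hcnj: "hcnj (hcnj f) = f"
  by (rule poly_mapping_eqI) (simp add: hcnj_def lookup_map_0 qcnj_simps)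

lemma hcnj_mult: "hcnj (f * g) = hcnj g * hcnj f"
proof (induction f rule: mpoly_induct)
  case (single m b)
  show ?case
  proof (induction g rule: mpoly_induct)
    case (single n c)
    show ?case by (simp add: mult_single hcnj_single qcnj_simps add.commute)
  next
    case (add g h)
    then show ?case by (simp add: distrib_left distrib_right hcnj_add)
  qed
next
  case (add f h)
  then show ?case by (simp add: distrib_left distrib_right hcnj_add)
qed

lemma central_single:
  assumes "\<And>c. b * c = c * (b :: quat)"
  shows "central (Poly_Mapping.single m b :: 'd hpoly)"
  unfolding central_def
proof
  fix g :: "'d hpoly"
  show "Poly_Mapping.single m b * g = g * Poly_Mapping.single m b"
  proof (induction g rule: mpoly_induct)
    case (single n c)
    show ?case by (simp add: mult_single assms add.commute)
  next
    case (add g h)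
    then show ?case by (simp add: distrib_left distrib_right)
  qed
qed

lemma central_add: "central s \<Longrightarrow> central t \<Longrightarrow> central (s + t)"
  by (simp add: central_def distrib_left distrib_right)

lemma central_trace_hpoly: "central (f + hcnj f)" for f :: "'d hpoly"
proof (induction f rule: mpoly_induct)
  case (single m b)
  have "central (Poly_Mapping.single m (b + qcnj b) :: 'd hpoly)"
    by (rule central_single) (simp add: quat_eq_iff algebra_simps)
  then show ?case by (simp add: hcnj_single single_add)
next
  case (add f g)
  then have "central ((f + hcnj f) + (g + hcnj g))" by (rule central_add)
  then show ?case by (simp add: hcnj_add algebra_simps)
qed

lemma central_norm_hpoly: "central (hcnj f * f)" for f :: "'d hpoly"
proof (induction f rule: mpoly_induct)
  case (single m b)
  have "central (Poly_Mapping.single (m + m) (qcnj b * b) :: 'd hpoly)"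
    by (rule central_single) (simp add: quat_eq_iff algebra_simps)
  then show ?case by (simp add: hcnj_single mult_single)
next
  case (add f g)
  \<comment> \<open>The norm is quadratic; its polar form is a trace.\<close>
  have "hcnj (f + g) * (f + g) = hcnj f * f + hcnj g * g + (hcnj g * f + hcnj (hcnj g * f))"
    by (simp add: hcnj_add hcnj_mult hcnj_hcnj algebra_simps)
  then show ?case using add by (simp add: central_add central_trace_hpoly)
qed

interpretation hpoly: trace_involution "hcnj :: 'd hpoly \<Rightarrow> 'd hpoly"
  by standard (simp_all add: hcnj_mult hcnj_hcnj central_trace_hpoly central_norm_hpoly)

section \<open>Left ideals and powers in the two rings\<close>

lemma (in ring) left_ideal_iff:
  assumes "L \<subseteq> carrier R"
  shows "left_ideal L R \<longleftrightarrow> \<zero> \<in> L \<and> (\<forall>x\<in>L. \<forall>y\<in>L. x \<oplus> y \<in> L) \<and>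
    (\<forall>r\<in>carrier R. \<forall>x\<in>L. r \<otimes> x \<in> L)"
proof
  assume L: "\<zero> \<in> L \<and> (\<forall>x\<in>L. \<forall>y\<in>L. x \<oplus> y \<in> L) \<and> (\<forall>r\<in>carrier R. \<forall>x\<in>L. r \<otimes> x \<in> L)"
  have "\<ominus> x \<in> L" if "x \<in> L" for x
  proof -
    have "\<ominus> \<one> \<otimes> x \<in> L" using L that by simp
    then show ?thesis using that assms by (simp add: l_minus subsetD)
  qed
  then have "subgroup L (add_monoid R)"
    using L assms by unfold_locales (auto simp: a_inv_def)
  then show "left_ideal L R"
    using L by (simp add: left_ideal_def additive_subgroup.intro)
qed (simp add: left_ideal_def additive_subgroup.zero_closed additive_subgroup.a_closed)

lemma left_ideal_hpoly_ring: "left_ideal I hpoly_ring \<longleftrightarrow> lideal I"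
  using ring.left_ideal_iff[OF ring_hpoly_ring, of I] by (simp add: hpoly_ring_def lideal_def)

lemma left_ideal_cpoly_mat_ring: "left_ideal P cpoly_mat_ring \<longleftrightarrow> mat_lideal P"
  using ring.left_ideal_iff[OF ring_cpoly_mat_ring, of P]
  by (simp add: cpoly_mat_ring_def mat_lideal_def)

lemma semiprime_hpoly_ring:
  "semiprime_left_ideal J hpoly_ring \<longleftrightarrow> lideal J \<and> (\<forall>a. (\<forall>r. a * r * a \<in> J) \<longrightarrow> a \<in> J)"
  by (simp add: semiprime_left_ideal_def left_ideal_hpoly_ring) (simp add: hpoly_ring_def)

lemma semiprime_cpoly_mat_ring:
  "semiprime_left_ideal P cpoly_mat_ring \<longleftrightarrow>
     mat_lideal P \<and> (\<forall>M. (\<forall>B. M ** B ** M \<in> P) \<longrightarrow> M \<in> P)"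
  by (simp add: semiprime_left_ideal_def left_ideal_cpoly_mat_ring) (simp add: cpoly_mat_ring_def)

lemma nat_pow_hpoly_ring: "g [^]\<^bsub>hpoly_ring\<^esub> n = g ^ n" for g :: "'d hpoly"
  by (induction n) (simp_all add: hpoly_ring_def power_commutes)

lemma finsum_hpoly_ring:
  "(\<Oplus>\<^bsub>hpoly_ring\<^esub>k\<in>{..N}. h k) = (\<Sum>k\<le>(N::nat). h k)" for h :: "nat \<Rightarrow> 'd hpoly"
proof -
  interpret ring "hpoly_ring :: 'd hpoly ring" by (rule ring_hpoly_ring)
  have c: "carrier (hpoly_ring :: 'd hpoly ring) = UNIV"
    and a: "x \<oplus>\<^bsub>hpoly_ring\<^esub> y = x + y"
    and z: "\<zero>\<^bsub>hpoly_ring\<^esub> = (0 :: 'd hpoly)" for x y :: "'d hpoly"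
    by (auto simp: hpoly_ring_def)
  show ?thesis
    by (induction N) (simp_all add: c a z add.commute)
qed

lemma power_span_hpoly_ring:
  fixes g :: "'d hpoly"
  shows "power_span hpoly_ring I g N = {\<Sum>k\<le>N. u k * g ^ k | u. \<forall>k\<le>N. u k \<in> I}"
proof -
  have "x \<otimes>\<^bsub>hpoly_ring\<^esub> y = x * y" for x y :: "'d hpoly"
    by (simp add: hpoly_ring_def)
  then show ?thesis
    unfolding power_span_def finsum_hpoly_ring nat_pow_hpoly_ring by simp
qed

section \<open>The equivalences\<close>

lemma phi_power: "phi (g ^ n) = mpow (phi g) n"
  by (induction n) (simp_all add: phi_one phi_mult power_Suc2 del: power_Suc)

text \<open>
  The representation of a matrix as \<open>phi u + \<i> phi v\<close> is unique, so the relation can be read off in its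
  first component.
\<close>

lemma power_span_descent:
  assumes "mpow (phi g) N \<in> power_span cpoly_mat_ring (phi_ideal I) (phi g) N"
  shows "g ^ N \<in> power_span hpoly_ring I g N"
proof -
  obtain G where G: "\<forall>k\<le>N. G k \<in> phi_ideal I"
    and eq: "mpow (phi g) N = (\<Sum>k\<le>N. G k ** mpow (phi g) k)"
    using assms unfolding power_span_cpoly_mat_ring by blast
  have "\<forall>k. \<exists>u v. k \<le> N \<longrightarrow> u \<in> I \<and> v \<in> I \<and> G k = phi u + mat (Const \<i>) ** phi v"
    using G unfolding phi_ideal_eq by blast
  then obtain u v where uv: "\<And>k. k \<le> N \<Longrightarrow> u k \<in> I \<and> v k \<in> I \<and> G k = phi (u k) + mat (Const \<i>) ** phi (v k)"
    by metis
  have "phi (g ^ N) = (\<Sum>k\<le>N. (phi (u k) + mat (Const \<i>) ** phi (v k)) ** phi (g ^ k))"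
    unfolding phi_power eq using uv by (intro sum.cong) auto
  also have "\<dots> = phi (\<Sum>k\<le>N. u k * g ^ k) + mat (Const \<i>) ** phi (\<Sum>k\<le>N. v k * g ^ k)"
    by (simp add: matrix_add_rdistrib sum.distrib phi_sum phi_mult matrix_sum_ldistrib
        flip: matrix_mul_assoc)
  finally have "phi ((\<Sum>k\<le>N. u k * g ^ k) - g ^ N) + mat (Const \<i>) ** phi (\<Sum>k\<le>N. v k * g ^ k) = 0"
    by (simp add: phi_diff)
  from phi_complexification_unique[OF this] have "g ^ N = (\<Sum>k\<le>N. u k * g ^ k)"
    by simp
  then show ?thesis
    unfolding power_span_hpoly_ring using uv by blast
qed

text \<open>
  If \<open>M(c) w \<noteq> 0\<close>, some constant matrix \<open>B\<close> maps \<open>M(c) w\<close> to \<open>w\<close>, and then \<open>M(c) B M(c) w = M(c) w\<close>.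
\<close>

lemma semiprime_cpoly_mat_radical:
  "semiprime_left_ideal (cpoly_mat_radical L) cpoly_mat_ring"
proof -
  have ideal: "mat_lideal (cpoly_mat_radical L)"
    unfolding mat_lideal_def cpoly_mat_radical_def
    by (simp add: mat_value_add mat_value_mult matrix_vector_mult_add_rdistrib
        flip: matrix_vector_mul_assoc)
  have "M \<in> cpoly_mat_radical L" if M: "\<forall>B. M ** B ** M \<in> cpoly_mat_radical L" for M
    unfolding cpoly_mat_radical_def
  proof (intro CollectI allI impI)
    fix c w assume w: "w \<noteq> 0" "\<forall>G\<in>L. mat_value c G *v w = 0"
    show "mat_value c M *v w = 0"
    proof (rule ccontr)
      assume nz: "mat_value c M *v w \<noteq> 0"
      obtain h g where h: "w = quat_vec h" and g: "mat_value c M *v w = quat_vec g"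
        using surj_quat_vec by metis
      have "g \<noteq> 0" using nz g by auto
      then obtain k where "k * g = 1" using quat_inverse_exists by blast
      then have "quat_mat (h * k) *v quat_vec g = w"
        by (simp add: quat_mat_vec h mult.assoc)
      then have "quat_mat (h * k) *v (mat_value c M *v w) = w"
        unfolding g .
      moreover have "mat_value c (M ** map_matrix Const (quat_mat (h * k)) ** M) *v w = 0"
        using M w unfolding cpoly_mat_radical_def by blast
      then have "mat_value c M *v (quat_mat (h * k) *v (mat_value c M *v w)) = 0"
        by (simp add: mat_value_mult matrix_vector_mul_assoc matrix_mul_assoc)
      ultimately show False using nz by simp
    qed
  qed
  then show ?thesis unfolding semiprime_cpoly_mat_ring using ideal by blast
qed

text \<open>
  The real Nullstellensatz for semiprime left ideals: the radical satisfies the power condition over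
  \<open>J\<close> by the Nullstellensatz for matrices.
\<close>

lemma hpoly_radical_semiprime:
  fixes J :: "'d::{finite,linorder} hpoly set"
  assumes J: "semiprime_left_ideal J hpoly_ring"
  shows "hpoly_radical J = J"
proof -
  note J' = J[unfolded semiprime_hpoly_ring]
  have ideal: "lideal J" by (rule conjunct1[OF J'])
  have sp: "a \<in> J" if "\<And>r. a * r * a \<in> J" for a
    using conjunct2[OF J', rule_format] that .
  let ?R = "cpoly_mat_radical (phi_ideal J)"
  have rad: "mat_lideal ?R"
    using semiprime_cpoly_mat_radical[of "phi_ideal J"] by (simp add: semiprime_cpoly_mat_ring)
  have R: "hpoly_radical J = {f. phi f \<in> ?R}"
    using hpoly_radical_iff[OF ideal] by blast
  have "lideal (hpoly_radical J)"
    unfolding R lideal_def using mat_lidealD(1-3)[OF rad] by (simp add: phi_add phi_mult)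
  moreover have "J \<subseteq> hpoly_radical J"
    by (auto simp: hpoly_radical_def)
  moreover have "\<exists>N u. (\<forall>k\<le>N. u k \<in> J) \<and> g ^ N = (\<Sum>k\<le>N. u k * g ^ k)"
    if "g \<in> hpoly_radical J" for g
  proof -
    have "phi g \<in> ?R" using that R by blast
    then obtain N where "mpow (phi g) N \<in> power_span cpoly_mat_ring (phi_ideal J) (phi g) N"
      using matrix_nullstellensatz[OF mat_lideal_phi_ideal[OF ideal]] by blast
    then have "g ^ N \<in> power_span hpoly_ring J g N"
      by (rule power_span_descent)
    then show ?thesis unfolding power_span_hpoly_ring by blast
  qed
  ultimately show ?thesis
    by (intro hpoly.semiprime_lideal_power_closed[OF ideal sp])
qed

lemma semiprime_phi_vimage:
  fixes P :: "'d cpoly_mat set"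
  assumes P: "semiprime_left_ideal P cpoly_mat_ring"
  shows "semiprime_left_ideal {g. phi g \<in> P} hpoly_ring"
proof -
  note P' = P[unfolded semiprime_cpoly_mat_ring]
  have ideal: "mat_lideal P" by (rule conjunct1[OF P'])
  have sp: "M \<in> P" if "\<And>B. M ** B ** M \<in> P" for M
    using conjunct2[OF P', rule_format] that .
  have "lideal {g. phi g \<in> P}"
    unfolding lideal_def using mat_lidealD(1-3)[OF ideal] by (simp add: phi_add phi_mult)
  moreover have "phi a \<in> P" if a: "\<forall>r. phi (a * r * a) \<in> P" for a :: "'d hpoly"
  proof (rule sp)
    fix B :: "'d cpoly_mat"
    obtain b c where B: "B = phi b + mat (Const \<i>) ** phi c" by (rule phi_complexification)
    have "phi a ** B ** phi a = phi (a * b * a) + mat (Const \<i>) ** phi (a * c * a)"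
      unfolding B by (simp add: matrix_add_ldistrib matrix_add_rdistrib phi_mult mat_left_commute
          flip: matrix_mul_assoc)
    then show "phi a ** B ** phi a \<in> P"
      using a mat_lidealD(2,3)[OF ideal] by simp
  qed
  ultimately show ?thesis unfolding semiprime_hpoly_ring by blast
qed

text \<open>
  Suppose that \<open>(c, w)\<close> is a zero of \<open>I\<close> but not of \<open>f\<close>.  Quaternions act transitively on nonzero vectors, so
  some \<open>b\<close> makes \<open>w\<close> a fixed vector of \<open>b f\<close>.  Then \<open>(b f)\<^sup>N\<close> fixes \<open>w\<close> as well, while all \<open>u (b f)\<^sup>k\<close> with
  \<open>u \<in> I\<close> annihilate it.
\<close>

lemma power_membership_imp_radical:
  fixes I :: "'d::{finite,linorder} hpoly set"
  assumes I: "lideal I"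
    and pow: "\<And>b. \<exists>N. (Const b * f) ^ N \<in> power_span hpoly_ring I (Const b * f) N"
  shows "phi f \<in> cpoly_mat_radical (phi_ideal I)"
  unfolding cpoly_mat_radical_def mat_value_phi_ideal[OF I]
proof (intro CollectI allI impI)
  fix c w assume w: "w \<noteq> 0" and zero: "\<forall>u\<in>I. mat_value c (phi u) *v w = 0"
  show "mat_value c (phi f) *v w = 0"
  proof (rule ccontr)
    assume nz: "mat_value c (phi f) *v w \<noteq> 0"
    obtain h g where h: "w = quat_vec h" and g: "mat_value c (phi f) *v w = quat_vec g"
      using surj_quat_vec by metis
    have "g \<noteq> 0" using nz g by auto
    then obtain k where k: "k * g = 1" using quat_inverse_exists by blast
    define q where "q = Const (h * k) * f"
    have "mat_value c (phi q) *v w = quat_mat (h * k) *v (mat_value c (phi f) *v w)"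
      by (simp add: q_def phi_mult phi_Const mat_value_mult matrix_vector_mul_assoc)
    also have "\<dots> = quat_mat (h * k) *v quat_vec g"
      unfolding g ..
    also have "\<dots> = w"
      using k by (simp add: quat_mat_vec h mult.assoc)
    finally have fixed: "mat_value c (phi q) *v w = w" .
    have fixn: "mat_value c (phi (q ^ n)) *v w = w" for n
      by (induction n) (simp_all add: phi_one phi_mult mat_value_mult fixed flip: matrix_vector_mul_assoc)
    obtain N u where u: "\<forall>k\<le>N. u k \<in> I" and eq: "q ^ N = (\<Sum>k\<le>N. u k * q ^ k)"
      using pow[of "h * k"] unfolding q_def[symmetric] power_span_hpoly_ring by blast
    have add: "mat_value c (phi (sum F A)) *v w = (\<Sum>k\<in>A. mat_value c (phi (F k)) *v w)" for F and A :: "nat set"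
      by (induction A rule: infinite_finite_induct)
        (simp_all add: phi_add mat_value_add matrix_vector_mult_add_rdistrib)
    have "w = (\<Sum>k\<le>N. mat_value c (phi (u k * q ^ k)) *v w)"
      using fixn[of N] unfolding eq add by simp
    also have "\<dots> = 0"
      using u zero
      by (intro sum.neutral) (simp add: phi_mult mat_value_mult fixn flip: matrix_vector_mul_assoc)
    finally show False using w by simp
  qed
qed

theorem theoremA3:
  fixes I :: "'d::{finite,linorder} hpoly set" and f :: "'d hpoly"
  assumes "left_ideal I hpoly_ring"
  shows
    "(f \<in> hpoly_radical I \<longleftrightarrow> phi f \<in> cpoly_mat_radical (phi_ideal I)) \<and>
     (phi f \<in> cpoly_mat_radical (phi_ideal I) \<longleftrightarrow>
        phi f \<in> semiprime_closure cpoly_mat_ring (phi_ideal I)) \<and>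
     (phi f \<in> semiprime_closure cpoly_mat_ring (phi_ideal I) \<longleftrightarrow>
        f \<in> semiprime_closure hpoly_ring I) \<and>
     (f \<in> semiprime_closure hpoly_ring I \<longleftrightarrow>
        (\<forall>A :: complex ^ 2 ^ 2. \<exists>N.
           (map_matrix Const A ** phi f) [^]\<^bsub>cpoly_mat_ring\<^esub> N
             \<in> power_span cpoly_mat_ring (phi_ideal I) (map_matrix Const A ** phi f) N)) \<and>
     ((\<forall>A :: complex ^ 2 ^ 2. \<exists>N.
           (map_matrix Const A ** phi f) [^]\<^bsub>cpoly_mat_ring\<^esub> N
             \<in> power_span cpoly_mat_ring (phi_ideal I) (map_matrix Const A ** phi f) N) \<longleftrightarrow>
        (\<forall>b :: quat. \<exists>N.
           (Const b * f) [^]\<^bsub>hpoly_ring\<^esub> N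
             \<in> power_span hpoly_ring I (Const b * f) N))"
    (is "(?s1 \<longleftrightarrow> ?s2) \<and> (?s2 \<longleftrightarrow> ?s3) \<and> (?s3 \<longleftrightarrow> ?s4) \<and> (?s4 \<longleftrightarrow> ?s5) \<and> (?s5 \<longleftrightarrow> ?s6)")
proof -
  have I: "lideal I" using assms by (simp add: left_ideal_hpoly_ring)
  let ?R = "cpoly_mat_radical (phi_ideal I)"
  have rad: "mat_lideal ?R"
    using semiprime_cpoly_mat_radical[of "phi_ideal I"] by (simp add: semiprime_cpoly_mat_ring)
  have s12: "?s1 \<longleftrightarrow> ?s2" by (rule hpoly_radical_iff[OF I])
  have s14: ?s4 if f: ?s1
    unfolding semiprime_closure_def
  proof (intro InterI, elim CollectE conjE)
    fix J assume J: "semiprime_left_ideal J hpoly_ring" "I \<subseteq> J"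
    have "hpoly_radical I \<subseteq> hpoly_radical J"
      using J(2) by (auto simp: hpoly_radical_def)
    then show "f \<in> J"
      using f hpoly_radical_semiprime[OF J(1)] by blast
  qed
  have s43: ?s3 if f: ?s4
    unfolding semiprime_closure_def
  proof (intro InterI, elim CollectE conjE)
    fix P assume P: "semiprime_left_ideal P cpoly_mat_ring" "phi_ideal I \<subseteq> P"
    have "I \<subseteq> {g. phi g \<in> P}"
      using P(2) phi_mem_phi_ideal[OF I] by blast
    then have "f \<in> {g. phi g \<in> P}"
      using f semiprime_phi_vimage[OF P(1)] unfolding semiprime_closure_def by blast
    then show "phi f \<in> P" by simp
  qed
  have s32: ?s2 if ?s3
  proof -
    have "phi_ideal I \<subseteq> ?R" by (auto simp: cpoly_mat_radical_def)
    then show ?thesis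
      using that semiprime_cpoly_mat_radical unfolding semiprime_closure_def by blast
  qed
  have s25: ?s5 if ?s2
    using matrix_nullstellensatz[OF mat_lideal_phi_ideal[OF I] mat_lidealD(3)[OF rad that]]
    by (simp add: nat_pow_cpoly_mat_ring)
  have s56: ?s6 if s5: ?s5
  proof
    fix b
    have "map_matrix Const (quat_mat b) ** phi f = phi (Const b * f)"
      by (simp add: phi_mult phi_Const)
    then obtain N where "mpow (phi (Const b * f)) N
        \<in> power_span cpoly_mat_ring (phi_ideal I) (phi (Const b * f)) N"
      using s5[rule_format, of "quat_mat b"] by (auto simp: nat_pow_cpoly_mat_ring)
    from power_span_descent[OF this]
    show "\<exists>N. (Const b * f) [^]\<^bsub>hpoly_ring\<^esub> N \<in> power_span hpoly_ring I (Const b * f) N"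
      unfolding nat_pow_hpoly_ring by blast
  qed
  have s62: ?s2 if ?s6
    using power_membership_imp_radical[OF I] that unfolding nat_pow_hpoly_ring by blast
  show ?thesis
    using s12 s14 s43 s32 s25 s56 s62 by argo
qed

end
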